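(* Suppose that $F$ is boundedly Lipschitz with constants $L$ and $D$: $\|F(z_1)-F(z_2)\|^2\le L^2\|z_1-z_2\|^2+D^2$ for all $z_1,z_2\in\mathcal Z$. Let the iterates be generated by Coord-ES: $z^0=w^0\in\mathcal Z$ and, for $k=0,\dots,K-1$, $\bar z^k=\tau z^k+(1-\tau)w^k$, $i_k$ uniform on $\{1,\dots,d\}$, $$z^{k+1/2}=\mathrm{prox}_{\gamma h}(\bar z^k-\gamma F(w^k)),$$ $$z^{k+1}=\mathrm{prox}_{\gamma h}\big(\bar z^k-\gamma(d[F(z^{k+1/2})]_{i_k}e_{i_k}-d[F(w^k)]_{i_k}e_{i_k}+F(w^k))\big),$$ $w^{k+1}=z^{k+1}$ with probability $1-\tau$ and $w^{k+1}=w^k$ with probability $\tau$. Then: (i) in the strongly monotone case with $0<\gamma\le\min\left\{\frac{\sqrt{1-\tau}}{2\sqrt{2d}L};\frac{1-\tau}{4(\mu_F+\mu_h)}\right\}$, $$\mathbb{E}\big[\tau\|z^K-z^*\|^2+\|w^K-z^*\|^2\big]\le\left(1-\gamma\cdot\frac{\mu_F+\mu_h}{16}\right)^{K-1}\big(\tau\|z^0-z^*\|^2+\|w^0-z^*\|^2\big)+\frac{32\gamma dD^2}{\mu_F+\mu_h};$$ (ii) in the monotone case with $0<\gamma\le\frac{\sqrt{1-\tau}}{2L\sqrt{4d+2}}$, $$\mathbb{E}[\mathrm{Gap}(\hat z^K)]\le\frac{8\max_{u\in\mathcal C}\|z^0-u\|^2}{\gamma K}+\gamma(9d+2)D^2,\qquad\hat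 z^K=\frac1K\sum_{k=0}^{K-1}z^{k+1/2}.$$
   Context: $h:\mathbb{R}^d\to\mathbb{R}\cup\{+\infty\}$ is proper, lower semicontinuous, convex; $F:\mathbb{R}^d\to\mathbb{R}^d$; $\mathcal Z\subseteq\mathbb{R}^d$ is nonempty, closed, convex, with $\mathrm{dom}\,h\subseteq\mathcal Z$; $\tau\in[0,1)$. $[x]_i$ is the $i$-th coordinate of $x$ and $e_i$ the $i$-th standard basis vector. $z^*\in\mathcal Z$ is a solution of the variational inequality $\langle F(z^* ),z-z^*\rangle+h(z)-h(z^* )\ge0$ for all $z\in\mathcal Z$. $\mathrm{prox}_{\gamma h}(z)=\arg\min_x\{\gamma h(x)+\frac12\|z-x\|^2\}$. Strongly monotone case: there are $\mu_F,\mu_h\ge0$ with $\mu_F+\mu_h>0$ such that for all $z_1,z_2\in\mathcal Z$: $\langle F(z_1)-F(z_2),z_1-z_2\rangle\ge\mu_F\|z_1-z_2\|^2$ and $h(z_1)-h(z_2)-\langle\nabla h(z_2),z_1-z_2\rangle\ge\frac{\mu_h}{2}\|z_1-z_2\|^2$ ($\nabla h$ denotes a subgradient). Monotone case: the same with $\mu_F=\mu_h=0$. $\mathrm{Gap}(z)=\max_{u\in\mathcal C}[\langle F(u),z-u\rangle+h(z)-h(u)]$, where $\mathcal C$ is a compact subset of $\mathcal Z$ containing $z^*$. $z^0$ is deterministic, $K\ge1$, and all random choices are made independently of everything generated before them. *)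

theory Defs
  imports "HOL-Probability.Probability"
begin

text \<open>Functions into \<open>\<real> \<union> {+\<infinity>}\<close> are modelled by \<^typ>\<open>ereal\<close>-valued functions that never take the
  value \<open>-\<infinity>\<close> (part of properness).\<close>

definition edom :: "('a \<Rightarrow> ereal) \<Rightarrow> 'a set" where
  "edom h = {x. h x < \<infinity>}"

definition proper_fun :: "('a \<Rightarrow> ereal) \<Rightarrow> bool" where
  "proper_fun h \<longleftrightarrow> (\<forall>x. h x \<noteq> -\<infinity>) \<and> edom h \<noteq> {}"

definition lower_semicontinuous :: "('a::topological_space \<Rightarrow> ereal) \<Rightarrow> bool" where
  "lower_semicontinuous h \<longleftrightarrow> (\<forall>x. h x \<le> Liminf (at x) h)"

text \<open>For \<open>h\<close> without value \<open>-\<infinity>\<close> the right-hand side never involves \<open>\<infinity> - \<infinity>\<close>; in \<^typ>\<open>ereal\<close>,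
  \<open>0 * \<infinity> = 0\<close>.\<close>

definition econvex :: "('a::real_vector \<Rightarrow> ereal) \<Rightarrow> bool" where
  "econvex h \<longleftrightarrow> (\<forall>x y. \<forall>t\<in>{0..1::real}.
     h ((1 - t) *\<^sub>R x + t *\<^sub>R y) \<le> ereal (1 - t) * h x + ereal t * h y)"

definition subdifferential :: "('a::real_inner \<Rightarrow> ereal) \<Rightarrow> 'a \<Rightarrow> 'a set" where
  "subdifferential h z =
     {g. z \<in> edom h \<and> (\<forall>y. h y \<ge> h z + ereal (inner g (y - z)))}"

definition prox :: "real \<Rightarrow> ('a::real_normed_vector \<Rightarrow> ereal) \<Rightarrow> 'a \<Rightarrow> 'a" where
  "prox \<gamma> h z = (ARG_MIN (\<lambda>x. ereal \<gamma> * h x + ereal (1/2 * (norm (z - x))\<^sup>2)) x. True)"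

definition solves_VI ::
  "'a::real_inner set \<Rightarrow> ('a \<Rightarrow> 'a) \<Rightarrow> ('a \<Rightarrow> ereal) \<Rightarrow> 'a \<Rightarrow> bool" where
  "solves_VI Z F h zs \<longleftrightarrow>
     zs \<in> Z \<and> (\<forall>z\<in>Z. ereal (inner (F zs) (z - zs)) + h z - h zs \<ge> 0)"

definition boundedly_Lipschitz ::
  "'a::real_normed_vector set \<Rightarrow> ('a \<Rightarrow> 'a) \<Rightarrow> real \<Rightarrow> real \<Rightarrow> bool" where
  "boundedly_Lipschitz Z F L D \<longleftrightarrow>
     (\<forall>z1\<in>Z. \<forall>z2\<in>Z. (norm (F z1 - F z2))\<^sup>2 \<le> L\<^sup>2 * (norm (z1 - z2))\<^sup>2 + D\<^sup>2)"

text \<open>The inequality for \<open>h\<close> is required for every subgradient \<open>g\<close> of \<open>h\<close> at \<open>z2\<close>.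
  The merely monotone case is \<open>\<mu>F = \<mu>h = 0\<close>.\<close>

definition strongly_monotone ::
  "'a::real_inner set \<Rightarrow> ('a \<Rightarrow> 'a) \<Rightarrow> ('a \<Rightarrow> ereal) \<Rightarrow> real \<Rightarrow> real \<Rightarrow> bool" where
  "strongly_monotone Z F h \<mu>F \<mu>h \<longleftrightarrow>
     (\<forall>z1\<in>Z. \<forall>z2\<in>Z. inner (F z1 - F z2) (z1 - z2) \<ge> \<mu>F * (norm (z1 - z2))\<^sup>2) \<and>
     (\<forall>z1\<in>Z. \<forall>z2\<in>Z. \<forall>g\<in>subdifferential h z2.
        h z1 - h z2 - ereal (inner g (z1 - z2)) \<ge> ereal (\<mu>h / 2 * (norm (z1 - z2))\<^sup>2))"

text \<open>The maximum is read as a supremum, since \<open>F\<close> need not be continuous.\<close>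

definition Gap ::
  "'a::real_inner set \<Rightarrow> ('a \<Rightarrow> 'a) \<Rightarrow> ('a \<Rightarrow> ereal) \<Rightarrow> 'a \<Rightarrow> ereal" where
  "Gap C F h z = (SUP u\<in>C. ereal (inner (F u) (z - u)) + h z - h u)"

text \<open>\<open>i k\<close> is the sampled coordinate and \<open>b k\<close> the coin deciding whether \<open>w\<close> is refreshed in
  step \<open>k\<close>. The sum types only serve to put both kinds of variables into one jointly
  independent family of \<open>2 * K\<close> members.\<close>

definition coord_es_choices ::
  "'s measure \<Rightarrow> nat \<Rightarrow> real \<Rightarrow> (nat \<Rightarrow> 's \<Rightarrow> 'd::finite) \<Rightarrow> (nat \<Rightarrow> 's \<Rightarrow> bool) \<Rightarrow> bool" where
  "coord_es_choices M K \<tau> i b \<longleftrightarrow>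
     prob_space M \<and>
     prob_space.indep_vars M (\<lambda>_. count_space UNIV)
       (case_sum (\<lambda>k \<omega>. Inl (i k \<omega>)) (\<lambda>k \<omega>. Inr (b k \<omega>))) ({..<K} <+> {..<K}) \<and>
     (\<forall>k<K. \<forall>j. measure M {\<omega>\<in>space M. i k \<omega> = j} = 1 / real CARD('d)) \<and>
     (\<forall>k<K. measure M {\<omega>\<in>space M. b k \<omega>} = 1 - \<tau>)"

text \<open>\<open>zh k\<close> is the half step \<open>z\<^sup>k\<^sup>+\<^sup>1\<^sup>/\<^sup>2\<close>, \<open>axis j 1\<close> is the standard basis vector \<open>e\<^sub>j\<close>.\<close>

definition coord_es_iterates ::
  "'s measure \<Rightarrow> nat \<Rightarrow> real \<Rightarrow> real \<Rightarrow> (real^'d::finite \<Rightarrow> real^'d) \<Rightarrow> (real^'d \<Rightarrow> ereal) \<Rightarrow>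
   real^'d \<Rightarrow> (nat \<Rightarrow> 's \<Rightarrow> 'd) \<Rightarrow> (nat \<Rightarrow> 's \<Rightarrow> bool) \<Rightarrow>
   (nat \<Rightarrow> 's \<Rightarrow> real^'d) \<Rightarrow> (nat \<Rightarrow> 's \<Rightarrow> real^'d) \<Rightarrow> (nat \<Rightarrow> 's \<Rightarrow> real^'d) \<Rightarrow> bool" where
  "coord_es_iterates M K \<tau> \<gamma> F h z0 i b z w zh \<longleftrightarrow>
     (\<forall>\<omega>\<in>space M. z 0 \<omega> = z0 \<and> w 0 \<omega> = z0 \<and>
       (\<forall>k<K.
          let d = real CARD('d);
              zbar = \<tau> *\<^sub>R z k \<omega> + (1 - \<tau>) *\<^sub>R w k \<omega>;
              j = i k \<omega>
          in zh k \<omega> = prox \<gamma> h (zbar - \<gamma> *\<^sub>R F (w k \<omega>)) \<and>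
             z (Suc k) \<omega> = prox \<gamma> h (zbar - \<gamma> *\<^sub>R
               ((d * F (zh k \<omega>) $ j) *\<^sub>R axis j 1 - (d * F (w k \<omega>) $ j) *\<^sub>R axis j 1
                + F (w k \<omega>))) \<and>
             w (Suc k) \<omega> = (if b k \<omega> then z (Suc k) \<omega> else w k \<omega>)))"

end

theory Submission
  imports Defs
begin

text \<open>Combining the prox inequalities of the half and the full step gives, for every \<open>u\<close> in the domain
  of \<open>h\<close>, a one-step estimate for \<open>(norm (z\<^sup>k\<^sup>+\<^sup>1 - u))\<^sup>2\<close> whose only random perturbation is the coordinate
  estimator \<open>e\<close> of \<open>F z\<^sup>k\<^sup>+\<^sup>1\<^sup>/\<^sup>2 - F w\<^sup>k\<close>, with mean equal to that difference and second moment \<open>d\<close> times its square.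

  For \<open>u = z\<^sup>*\<close> the conditional expectation of this estimate makes \<open>\<tau> * (norm (z - z\<^sup>*))\<^sup>2 + (norm (w - z\<^sup>*))\<^sup>2\<close>
  contract by \<open>1 - \<gamma> * \<mu> / 16\<close> up to \<open>\<gamma>\<^sup>2 * d * D\<^sup>2\<close>. For the gap, \<open>u\<close> may depend on the sample, so
  the noise is split as \<open>2 * inner S (u - z0) + Y\<close> with \<open>S\<close> and \<open>Y\<close> independent of \<open>u\<close>; Young's
  inequality bounds the first part by \<open>(norm S)\<^sup>2 / 6 + 6 * (norm (u - z0))\<^sup>2\<close>, and \<open>Y + (norm S)\<^sup>2 / 6\<close>
  grows in mean by at most \<open>3 / 2 * \<gamma>\<^sup>2 * d * D\<^sup>2\<close> per step.\<close>

subsection \<open>Proximal points of convex functions\<close>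

text \<open>The definition controls \<open>f\<close> only on punctured neighbourhoods; as
  \<open>x\<close> itself lies in the superlevel set, the puncture can be filled in.\<close>

lemma open_superlevel_lsc:
  fixes f :: "'a::topological_space \<Rightarrow> ereal"
  assumes "lower_semicontinuous f"
  shows "open {x. c < f x}"
proof (subst open_subopen, intro ballI)
  fix x assume x: "x \<in> {x. c < f x}"
  have "eventually (\<lambda>y. c < f y) (at x)"
    using assms x unfolding lower_semicontinuous_def le_Liminf_iff by auto
  then have "eventually (\<lambda>y. c < f y) (nhds x)"
    using x by (auto simp: eventually_at_filter elim: eventually_mono)
  then show "\<exists>T. open T \<and> x \<in> T \<and> T \<subseteq> {x. c < f x}"
    unfolding eventually_nhds by blast
qed

text \<open>Without a minimal point the open sets \<open>{x. f y < f x}\<close> would cover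
  \<open>S\<close>; in a finite subcover, the index with the least value lies in none of its
  members.\<close>

lemma lsc_attains_min:
  fixes f :: "'a::topological_space \<Rightarrow> ereal"
  assumes "lower_semicontinuous f" "compact S" "S \<noteq> {}"
  shows "\<exists>x\<in>S. \<forall>y\<in>S. f x \<le> f y"
proof (rule ccontr)
  assume neg: "\<not> ?thesis"
  then have cover: "S \<subseteq> (\<Union>y\<in>S. {x. f y < f x})"
    by (force simp: not_le)
  have "\<exists>D\<subseteq>S. finite D \<and> S \<subseteq> (\<Union>y\<in>D. {x. f y < f x})"
    using compactE_image[OF \<open>compact S\<close> _ cover] open_superlevel_lsc[OF assms(1)] by metis
  then obtain D where D: "D \<subseteq> S" "finite D" "S \<subseteq> (\<Union>y\<in>D. {x. f y < f x})"
    by blast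
  with \<open>S \<noteq> {}\<close> have "D \<noteq> {}" by blast
  then obtain y where y: "y \<in> D" "\<forall>x\<in>D. f y \<le> f x"
    using D(2) ex_min_if_finite[of "f ` D"] by (auto simp: not_less)
  then obtain y' where "y' \<in> D" "f y' < f y" using D by blast
  with y show False by (auto simp: not_le[symmetric])
qed

lemma lsc_add_continuous:
  fixes f :: "'a::topological_space \<Rightarrow> ereal" and g :: "'a \<Rightarrow> real"
  assumes f: "lower_semicontinuous f" and "\<gamma> > 0" and fin: "\<And>x. f x \<noteq> -\<infinity>"
    and g: "continuous_on UNIV g"
  shows "lower_semicontinuous (\<lambda>x. ereal \<gamma> * f x + ereal (g x))"
  unfolding lower_semicontinuous_def le_Liminf_iff
proof (intro allI impI)
  fix x c assume c: "c < ereal \<gamma> * f x + ereal (g x)"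
  show "eventually (\<lambda>y. c < ereal \<gamma> * f y + ereal (g y)) (at x)"
  proof (cases c)
    case (real r)
    have "ereal ((r - g x) / \<gamma>) < f x"
      using c real fin[of x] \<open>\<gamma> > 0\<close> by (cases "f x") (auto simp: field_simps)
    \<comment> \<open>The intermediate value \<open>s\<close> splits the slack: near
      \<open>x\<close>, \<open>f\<close> stays above \<open>s\<close> and \<open>g\<close> above
      \<open>r - \<gamma> * s\<close>.\<close>
    then obtain s where s: "ereal ((r - g x) / \<gamma>) < ereal s" "ereal s < f x"
      using ereal_dense2 by blast
    have "eventually (\<lambda>y. ereal s < f y) (at x)"
      using f s(2) unfolding lower_semicontinuous_def le_Liminf_iff by auto
    moreover have "eventually (\<lambda>y. r - \<gamma> * s < g y) (at x)"
    proof (rule order_tendstoD)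
      show "(g \<longlongrightarrow> g x) (at x)"
        using g by (simp add: continuous_on_def)
      show "r - \<gamma> * s < g x" using s(1) \<open>\<gamma> > 0\<close> by (simp add: field_simps)
    qed
    ultimately show ?thesis
    proof eventually_elim
      case (elim y)
      show ?case
      proof (cases "f y")
        case (real q)
        with elim have "\<gamma> * s < \<gamma> * q" using \<open>\<gamma> > 0\<close> by simp
        then show ?thesis using elim real \<open>c = ereal r\<close> by simp
      qed (use fin[of y] \<open>c = ereal r\<close> \<open>\<gamma> > 0\<close> in auto)
    qed
  next
    case PInf then show ?thesis using c by simp
  next
    case MInf
    have "-\<infinity> < ereal \<gamma> * f y + ereal (g y)" for y
      using fin[of y] \<open>\<gamma> > 0\<close> by (cases "f y") auto
    then show ?thesis using MInf by simp
  qed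
qed

lemma econvexD_real:
  assumes "econvex h" "h x = ereal a" "h y = ereal b" "0 \<le> t" "t \<le> (1::real)"
  shows "h ((1 - t) *\<^sub>R x + t *\<^sub>R y) \<le> ereal ((1 - t) * a + t * b)"
  using assms unfolding econvex_def by (metis atLeastAtMost_iff plus_ereal.simps(1) times_ereal.simps(1))

lemma proper_fun_edomE:
  assumes "proper_fun h" "x \<in> edom h"
  obtains a where "h x = ereal a"
  using assms unfolding proper_fun_def edom_def by (cases "h x") auto

lemma proper_fun_finite_valueE:
  assumes "proper_fun h"
  obtains x a where "h x = ereal a"
  using assms proper_fun_edomE[OF assms] that unfolding proper_fun_def by (metis ex_in_conv)

text \<open>Lower semicontinuity bounds \<open>h\<close> from below on the unit ball around a point of its domain, and
  convexity along rays propagates the bound; no separation theorem is needed.\<close>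

lemma linear_lower_bound:
  fixes h :: "'a::euclidean_space \<Rightarrow> ereal"
  assumes "proper_fun h" "lower_semicontinuous h" "econvex h" "h x0 = ereal h0"
  obtains A where "0 \<le> A" "\<forall>x. ereal (h0 - A - A * norm (x - x0)) \<le> h x"
proof -
  obtain p where p: "p \<in> cball x0 1" "\<forall>y\<in>cball x0 1. h p \<le> h y"
    using lsc_attains_min[OF assms(2), of "cball x0 1"] by auto
  have "h p \<le> ereal h0" using p(2) assms(4) by (metis centre_in_cball zero_le_one)
  then obtain m where m: "h p = ereal m"
    using assms(1) unfolding proper_fun_def by (cases "h p") auto
  define A where "A = h0 - m"
  have A: "0 \<le> A" using \<open>h p \<le> ereal h0\<close> m by (simp add: A_def)
  have "ereal (m - A * norm (x - x0)) \<le> h x" for x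
  proof (cases "norm (x - x0) \<le> 1")
    case True
    then have "x \<in> cball x0 1" by (simp add: dist_norm norm_minus_commute)
    with p m have "ereal m \<le> h x" by metis
    moreover have "0 \<le> A * norm (x - x0)" using A by simp
    ultimately show ?thesis by (cases "h x") auto
  next
    case False
    \<comment> \<open>This \<open>t\<close> puts \<open>x0 + t *\<^sub>R (x - x0)\<close> on the
      unit sphere around \<open>x0\<close>, where the ball minimum \<open>m\<close> bounds
      \<open>h\<close>.\<close>
    define t where "t = 1 / norm (x - x0)"
    have t: "0 < t" "t \<le> 1" "t * norm (x - x0) = 1" using False by (auto simp: t_def divide_le_eq)
    show ?thesis
    proof (cases "h x")
      case (real a)
      have "(1 - t) *\<^sub>R x0 + t *\<^sub>R x = x0 + t *\<^sub>R (x - x0)" by (simp add: algebra_simps)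
      moreover have "x0 + t *\<^sub>R (x - x0) \<in> cball x0 1"
        using t by (simp add: dist_norm)
      ultimately have "ereal m \<le> ereal ((1 - t) * h0 + t * a)"
        using p m econvexD_real[OF assms(3,4) real, of t] t by (metis less_imp_le order_trans)
      then have "m \<le> (1 - t) * h0 + t * a" by simp
      then have "0 \<le> t * (a - h0) + A" by (simp add: A_def algebra_simps)
      then have "0 \<le> norm (x - x0) * (t * (a - h0) + A)" by simp
      also have "\<dots> = (t * norm (x - x0)) * (a - h0) + A * norm (x - x0)" by (simp add: algebra_simps)
      finally have "h0 - A * norm (x - x0) \<le> a" using t by simp
      then show ?thesis using real A by (simp add: A_def)
    qed (use assms(1) in \<open>auto simp: proper_fun_def\<close>)
  qed
  then have "ereal (h0 - A - A * norm (x - x0)) \<le> h x" for x by (simp add: A_def)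
  with A show ?thesis by (intro that allI)
qed

text \<open>Coercivity: the quadratic term beats the linear lower bound of \<open>h\<close>, so
  outside a large ball the objective is at least its value at \<open>x0\<close>, and a minimum over
  the ball is global.\<close>

lemma prox_objective_attains_min:
  fixes h :: "'a::euclidean_space \<Rightarrow> ereal"
  assumes h: "proper_fun h" "lower_semicontinuous h" "econvex h" and "\<gamma> > 0"
  shows "\<exists>x. \<forall>y. ereal \<gamma> * h x + ereal (1/2 * (norm (v - x))\<^sup>2)
                \<le> ereal \<gamma> * h y + ereal (1/2 * (norm (v - y))\<^sup>2)"
proof -
  let ?f = "\<lambda>x. ereal \<gamma> * h x + ereal (1/2 * (norm (v - x))\<^sup>2)"
  obtain x0 h0 where x0: "h x0 = ereal h0"
    using proper_fun_finite_valueE[OF h(1)] .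
  obtain A where A: "0 \<le> A" and lb: "\<forall>x. ereal (h0 - A - A * norm (x - x0)) \<le> h x"
    using linear_lower_bound[OF h x0] .
  define \<beta> where "\<beta> = norm (v - x0)"
  \<comment> \<open>Chosen so that \<open>R < \<rho>\<close> gives both
    \<open>1 \<le> \<rho>\<close> and
    \<open>\<gamma> * A \<le> \<rho> / 2 - \<beta> - \<gamma> * A\<close>.\<close>
  define R where "R = 2 * \<beta> + 4 * (\<gamma> * A) + 1"
  have gA: "0 \<le> \<gamma> * A" and \<beta>: "0 \<le> \<beta>" using A \<open>\<gamma> > 0\<close> by (auto simp: \<beta>_def)
  then have R: "0 \<le> R" by (simp add: R_def)
  have lsc: "lower_semicontinuous ?f"
    using h(1) by (intro lsc_add_continuous[OF h(2) \<open>\<gamma> > 0\<close>])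
      (auto simp: proper_fun_def intro!: continuous_intros)
  obtain x where x: "\<forall>y\<in>cball x0 R. ?f x \<le> ?f y"
    using lsc_attains_min[OF lsc, of "cball x0 R"] R by auto
  have "?f x \<le> ?f y" for y
  proof (cases "y \<in> cball x0 R")
    case False
    define \<rho> where "\<rho> = norm (y - x0)"
    have \<rho>: "R < \<rho>" using False by (simp add: \<rho>_def dist_norm norm_minus_commute)
    have "\<rho> \<le> norm (v - y) + \<beta>"
      unfolding \<rho>_def \<beta>_def using norm_triangle_ineq4[of "v - x0" "v - y"] by (simp add: algebra_simps)
    moreover have "\<beta> \<le> \<rho>" using \<rho> \<beta> gA by (simp add: R_def)
    ultimately have "(\<rho> - \<beta>)\<^sup>2 \<le> (norm (v - y))\<^sup>2"
      by (intro power_mono) auto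
    moreover have "\<gamma> * A \<le> \<rho> * (\<rho> / 2 - \<beta> - \<gamma> * A)"
    proof -
      have "1 \<le> \<rho>" "\<gamma> * A \<le> \<rho> / 2 - \<beta> - \<gamma> * A"
        using \<rho> \<beta> gA unfolding R_def by linarith+
      then have "1 * (\<gamma> * A) \<le> \<rho> * (\<rho> / 2 - \<beta> - \<gamma> * A)"
        using gA by (intro mult_mono) auto
      then show ?thesis by simp
    qed
    moreover have "\<gamma> * (h0 - A - A * \<rho>) + 1/2 * (\<rho> - \<beta>)\<^sup>2
        = \<gamma> * h0 + 1/2 * \<beta>\<^sup>2 + (\<rho> * (\<rho> / 2 - \<beta> - \<gamma> * A) - \<gamma> * A)"
      by (simp add: power2_eq_square field_simps)
    ultimately have *: "\<gamma> * h0 + 1/2 * \<beta>\<^sup>2 \<le> \<gamma> * (h0 - A - A * \<rho>) + 1/2 * (norm (v - y))\<^sup>2"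
      by linarith
    have "?f x \<le> ?f x0" using x R by simp
    also have "\<dots> = ereal (\<gamma> * h0 + 1/2 * \<beta>\<^sup>2)" using x0 by (simp add: \<beta>_def)
    also have "\<dots> \<le> ereal (\<gamma> * (h0 - A - A * \<rho>) + 1/2 * (norm (v - y))\<^sup>2)" using * by simp
    also have "\<dots> \<le> ?f y"
    proof (cases "h y")
      case (real a)
      then have "h0 - A - A * \<rho> \<le> a" using lb[rule_format, of y] by (simp add: \<rho>_def)
      then have "\<gamma> * (h0 - A - A * \<rho>) \<le> \<gamma> * a" using \<open>\<gamma> > 0\<close> by simp
      then show ?thesis using real by simp
    qed (use h(1) \<open>\<gamma> > 0\<close> in \<open>auto simp: proper_fun_def\<close>)
    finally show ?thesis .
  qed (use x in simp)
  then show ?thesis by blast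
qed

text \<open>\<open>ARG_MIN\<close> is a choice operator; it has its intended meaning because a
  minimizer exists.\<close>

lemma prox_minimizes:
  fixes h :: "'a::euclidean_space \<Rightarrow> ereal"
  assumes "proper_fun h" "lower_semicontinuous h" "econvex h" "\<gamma> > 0"
  shows "ereal \<gamma> * h (prox \<gamma> h v) + ereal (1/2 * (norm (v - prox \<gamma> h v))\<^sup>2)
       \<le> ereal \<gamma> * h y + ereal (1/2 * (norm (v - y))\<^sup>2)"
proof -
  have "\<exists>x. is_arg_min (\<lambda>x. ereal \<gamma> * h x + ereal (1/2 * (norm (v - x))\<^sup>2)) (\<lambda>_. True) x"
    using prox_objective_attains_min[OF assms] by (simp add: is_arg_min_linorder)
  then have "is_arg_min (\<lambda>x. ereal \<gamma> * h x + ereal (1/2 * (norm (v - x))\<^sup>2)) (\<lambda>_. True) (prox \<gamma> h v)"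
    unfolding prox_def arg_min_def by (rule someI_ex)
  then show ?thesis by (simp add: is_arg_min_linorder)
qed

text \<open>First-order optimality: compare \<open>p\<close> with the points
  \<open>(1 - t) *\<^sub>R p + t *\<^sub>R y\<close> of the segment towards \<open>y\<close>, divide
  by \<open>t\<close>, and let \<open>t\<close> tend to 0, which removes the quadratic term.\<close>

lemma prox_subdifferential:
  fixes h :: "'a::euclidean_space \<Rightarrow> ereal"
  assumes h: "proper_fun h" "lower_semicontinuous h" "econvex h" and "\<gamma> > 0"
  shows "(1 / \<gamma>) *\<^sub>R (v - prox \<gamma> h v) \<in> subdifferential h (prox \<gamma> h v)"
proof -
  define p where "p = prox \<gamma> h v"
  note min = prox_minimizes[OF h \<open>\<gamma> > 0\<close>, of v, folded p_def]
  obtain x0 h0 where x0: "h x0 = ereal h0"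
    using proper_fun_finite_valueE[OF h(1)] .
  obtain a where a: "h p = ereal a"
    using min[of x0] x0 h(1) \<open>\<gamma> > 0\<close> by (cases "h p") (auto simp: proper_fun_def)
  have "h p + ereal (inner ((1 / \<gamma>) *\<^sub>R (v - p)) (y - p)) \<le> h y" for y
  proof (cases "h y")
    case (real r)
    define c where "c = inner (v - p) (y - p) - \<gamma> * (r - a)"
    define B where "B = (norm (y - p))\<^sup>2 / 2"
    have cB: "c \<le> t * B" if t: "0 < t" "t \<le> 1" for t
    proof -
      obtain q where q: "h ((1 - t) *\<^sub>R p + t *\<^sub>R y) = ereal q" "q \<le> (1 - t) * a + t * r"
        using econvexD_real[OF h(3) a real, of t] t h(1)
        by (cases "h ((1 - t) *\<^sub>R p + t *\<^sub>R y)") (auto simp: proper_fun_def)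
      have "v - ((1 - t) *\<^sub>R p + t *\<^sub>R y) = (v - p) - t *\<^sub>R (y - p)" by (simp add: algebra_simps)
      then have n: "(norm (v - ((1 - t) *\<^sub>R p + t *\<^sub>R y)))\<^sup>2
          = (norm (v - p))\<^sup>2 - 2 * t * inner (v - p) (y - p) + t\<^sup>2 * (norm (y - p))\<^sup>2"
        unfolding \<open>v - _ = _\<close> power2_norm_eq_inner
        by (simp only: inner_diff_left inner_diff_right inner_scaleR_left inner_scaleR_right)
          (simp add: inner_commute algebra_simps power2_eq_square)
      have "\<gamma> * a + 1/2 * (norm (v - p))\<^sup>2
          \<le> \<gamma> * q + 1/2 * (norm (v - ((1 - t) *\<^sub>R p + t *\<^sub>R y)))\<^sup>2"
        using min[of "(1 - t) *\<^sub>R p + t *\<^sub>R y"] a q(1) by simp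
      moreover have "\<gamma> * q \<le> \<gamma> * ((1 - t) * a + t * r)"
        using q(2) \<open>\<gamma> > 0\<close> by simp
      ultimately have "t * c \<le> t * (t * B)"
        unfolding n c_def B_def by (simp add: algebra_simps power2_eq_square)
      then show ?thesis using t by simp
    qed
    have "c \<le> 0"
    proof (rule tendsto_lowerbound)
      show "((\<lambda>t. t * B) \<longlongrightarrow> 0) (at_right 0)" by (auto intro!: tendsto_eq_intros)
      show "\<forall>\<^sub>F t in at_right 0. c \<le> t * B"
        using cB by (auto simp: eventually_at_right_field intro!: exI[of _ 1])
    qed simp
    then have "inner (v - p) (y - p) / \<gamma> \<le> r - a"
      using \<open>\<gamma> > 0\<close> by (simp add: c_def divide_le_eq mult.commute)
    then have "a + inner ((1 / \<gamma>) *\<^sub>R (v - p)) (y - p) \<le> r" by simp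
    then show ?thesis using a real by (metis ereal_less_eq(3) plus_ereal.simps(1))
  qed (use h(1) in \<open>auto simp: proper_fun_def\<close>)
  then show ?thesis unfolding subdifferential_def edom_def p_def[symmetric] using a by auto
qed

section \<open>The prox inequality and the extragradient step\<close>

context
  fixes h :: "'a::euclidean_space \<Rightarrow> ereal" and \<gamma> :: real
  assumes h: "proper_fun h" "lower_semicontinuous h" "econvex h" and \<gamma>: "0 < \<gamma>"
begin

lemma ereal_real_edom: "x \<in> edom h \<Longrightarrow> ereal (real_of_ereal (h x)) = h x"
  using h(1) by (elim proper_fun_edomE[rotated]) auto

lemma prox_in_edom: "prox \<gamma> h v \<in> edom h"
  using prox_subdifferential[OF h \<gamma>] by (auto simp: subdifferential_def)

lemma prox_inequality:
  assumes "u \<in> edom h"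
  shows "inner (v - prox \<gamma> h v) (u - prox \<gamma> h v)
       \<le> \<gamma> * (real_of_ereal (h u) - real_of_ereal (h (prox \<gamma> h v)))"
proof -
  let ?p = "prox \<gamma> h v"
  have "h ?p + ereal (inner ((1 / \<gamma>) *\<^sub>R (v - ?p)) (u - ?p)) \<le> h u"
    using prox_subdifferential[OF h \<gamma>, of v] by (simp add: subdifferential_def)
  then have "real_of_ereal (h ?p) + inner (v - ?p) (u - ?p) / \<gamma> \<le> real_of_ereal (h u)"
    using ereal_real_edom[OF assms] ereal_real_edom[OF prox_in_edom, of v, symmetric]
    by (cases "h u"; cases "h ?p") auto
  then have "inner (v - ?p) (u - ?p) / \<gamma> \<le> real_of_ereal (h u) - real_of_ereal (h ?p)" by simp
  then show ?thesis using \<gamma> by (simp add: divide_le_eq mult.commute)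
qed

text \<open>Apart from the linear term, whose mean is harmless for random \<open>e\<close>, the perturbation \<open>e\<close> of the
  full step costs only \<open>\<gamma>\<^sup>2 * (norm e)\<^sup>2\<close>.\<close>

lemma extragradient_step:
  fixes z w g e u :: 'a and \<tau> :: real
  assumes u: "u \<in> edom h"
  defines "zb \<equiv> \<tau> *\<^sub>R z + (1 - \<tau>) *\<^sub>R w"
  defines "zh \<equiv> prox \<gamma> h (zb - \<gamma> *\<^sub>R g)" and "zp \<equiv> prox \<gamma> h (zb - \<gamma> *\<^sub>R (e + g))"
  shows "(norm (zp - u))\<^sup>2 \<le> \<tau> * (norm (z - u))\<^sup>2 + (1 - \<tau>) * (norm (w - u))\<^sup>2
      - (1 - \<tau>) * (norm (w - zh))\<^sup>2 - \<tau> * (norm (z - zh))\<^sup>2 + \<gamma>\<^sup>2 * (norm e)\<^sup>2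
      - 2 * \<gamma> * (inner (g + e) (zh - u) + real_of_ereal (h zh) - real_of_ereal (h u))"
proof -
  \<comment> \<open>The full step is tested at \<open>u\<close> and the half step at
    \<open>zp\<close>, so that the values of \<open>h\<close> at \<open>zp\<close> cancel in the
    sum.\<close>
  have 1: "inner (zb - \<gamma> *\<^sub>R (e + g) - zp) (u - zp) \<le> \<gamma> * (real_of_ereal (h u) - real_of_ereal (h zp))"
    unfolding zp_def by (rule prox_inequality[OF u])
  have 2: "inner (zb - \<gamma> *\<^sub>R g - zh) (zp - zh) \<le> \<gamma> * (real_of_ereal (h zp) - real_of_ereal (h zh))"
    unfolding zh_def by (rule prox_inequality) (simp add: zp_def prox_in_edom)
  \<comment> \<open>This square lets \<open>(norm (zp - zh))\<^sup>2\<close> absorb the cross term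
    \<open>2 * \<gamma> * inner e (zp - zh)\<close> at the price
    \<open>\<gamma>\<^sup>2 * (norm e)\<^sup>2\<close>.\<close>
  have 3: "0 \<le> (norm (\<gamma> *\<^sub>R e + (zp - zh)))\<^sup>2" by simp
  \<comment> \<open>The difference of the two squares is affine in \<open>zb\<close>, hence splits
    along the combination of \<open>z\<close> and \<open>w\<close>.\<close>
  have 4: "(norm (zb - u))\<^sup>2 - (norm (zb - zh))\<^sup>2 = \<tau> * (norm (z - u))\<^sup>2 + (1 - \<tau>) * (norm (w - u))\<^sup>2
      - (1 - \<tau>) * (norm (w - zh))\<^sup>2 - \<tau> * (norm (z - zh))\<^sup>2"
    unfolding zb_def power2_norm_eq_inner
    by (simp add: inner_simps inner_commute algebra_simps)
  have 5: "2 * inner (zb - \<gamma> *\<^sub>R (e + g) - zp) (u - zp) + 2 * inner (zb - \<gamma> *\<^sub>R g - zh) (zp - zh)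
    = (norm (zp - u))\<^sup>2 - ((norm (zb - u))\<^sup>2 - (norm (zb - zh))\<^sup>2) + (norm (zp - zh))\<^sup>2
       + 2 * \<gamma> * inner (g + e) (zh - u) + 2 * \<gamma> * inner e (zp - zh)"
    unfolding power2_norm_eq_inner by (simp add: inner_simps inner_commute algebra_simps)
  have 6: "(norm (\<gamma> *\<^sub>R e + (zp - zh)))\<^sup>2
      = \<gamma>\<^sup>2 * (norm e)\<^sup>2 + 2 * \<gamma> * inner e (zp - zh) + (norm (zp - zh))\<^sup>2"
    unfolding power2_norm_eq_inner by (simp add: inner_simps inner_commute algebra_simps power2_eq_square)
  have 7: "\<gamma> * (real_of_ereal (h u) - real_of_ereal (h zp)) + \<gamma> * (real_of_ereal (h zp) - real_of_ereal (h zh))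
      = \<gamma> * (real_of_ereal (h u) - real_of_ereal (h zh))"
    and 8: "2 * \<gamma> * (inner (g + e) (zh - u) + real_of_ereal (h zh) - real_of_ereal (h u))
      = 2 * \<gamma> * inner (g + e) (zh - u) - 2 * (\<gamma> * (real_of_ereal (h u) - real_of_ereal (h zh)))"
    by (simp_all only: algebra_simps)
  show ?thesis
    using 1 2 3 4 5 6 7 unfolding 8 by linarith
qed

text \<open>Nonexpansiveness of \<open>prox\<close>: the two prox inequalities, each tested at the
  other point, give \<open>(norm (p - q))\<^sup>2 \<le> - \<gamma> * inner e (p - q)\<close>, and
  completing the square finishes.\<close>

lemma prox_step_distance:
  fixes v e :: 'a
  shows "(norm (prox \<gamma> h (v - \<gamma> *\<^sub>R e) - prox \<gamma> h v))\<^sup>2 \<le> \<gamma>\<^sup>2 * (norm e)\<^sup>2"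
proof -
  define p q where "p = prox \<gamma> h (v - \<gamma> *\<^sub>R e)" and "q = prox \<gamma> h v"
  have "inner (v - \<gamma> *\<^sub>R e - p) (q - p) \<le> \<gamma> * (real_of_ereal (h q) - real_of_ereal (h p))"
    "inner (v - q) (p - q) \<le> \<gamma> * (real_of_ereal (h p) - real_of_ereal (h q))"
    unfolding p_def q_def by (rule prox_inequality[OF prox_in_edom])+
  then have "(norm (p - q))\<^sup>2 \<le> - \<gamma> * inner e (p - q)"
    unfolding power2_norm_eq_inner by (simp add: inner_simps inner_commute algebra_simps)
  moreover have "0 \<le> (norm (\<gamma> *\<^sub>R e + (p - q)))\<^sup>2" by simp
  moreover have "(norm (\<gamma> *\<^sub>R e + (p - q)))\<^sup>2 = \<gamma>\<^sup>2 * (norm e)\<^sup>2 + 2 * (\<gamma> * inner e (p - q)) + (norm (p - q))\<^sup>2"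
    unfolding power2_norm_eq_inner by (simp add: inner_simps inner_commute algebra_simps power2_eq_square)
  ultimately show ?thesis unfolding p_def q_def by linarith
qed

end

subsection \<open>Chains driven by the random choices\<close>

text \<open>Probability of one outcome: a uniform coordinate paired with an independent coin that
  shows \<open>True\<close> with probability \<open>1 - \<tau>\<close>.\<close>

definition choice_weight :: "real \<Rightarrow> 'd::finite \<times> bool \<Rightarrow> real" where
  "choice_weight \<tau> x = (if snd x then 1 - \<tau> else \<tau>) / real CARD('d)"

text \<open>Mean over one fresh draw with the past fixed; as a finite sum it stands in for a
  conditional expectation.\<close>

definition choice_mean :: "real \<Rightarrow> ('d::finite \<Rightarrow> bool \<Rightarrow> real) \<Rightarrow> real" where
  "choice_mean \<tau> \<phi> = (\<Sum>j\<in>UNIV. (1 - \<tau>) * \<phi> j True + \<tau> * \<phi> j False) / real CARD('d)"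

text \<open>The history as a list: it takes finitely many values, so expectations become weighted
  sums over lists of length \<open>n\<close>.\<close>

definition choices :: "(nat \<Rightarrow> 's \<Rightarrow> 'd) \<Rightarrow> (nat \<Rightarrow> 's \<Rightarrow> bool) \<Rightarrow> nat \<Rightarrow> 's \<Rightarrow> ('d \<times> bool) list" where
  "choices i b n \<omega> = map (\<lambda>k. (i k \<omega>, b k \<omega>)) [0..<n]"

lemma choice_mean_eq_sum: "choice_mean \<tau> \<phi> = (\<Sum>x\<in>UNIV. choice_weight \<tau> x * \<phi> (fst x) (snd x))"
proof -
  have "(\<Sum>x\<in>UNIV. choice_weight \<tau> x * \<phi> (fst x) (snd x))
      = (\<Sum>j\<in>UNIV. \<Sum>c\<in>UNIV. choice_weight \<tau> (j, c) * \<phi> j c)"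
    unfolding UNIV_Times_UNIV[symmetric] by (simp add: sum.cartesian_product case_prod_unfold)
  then show ?thesis
    by (simp add: choice_mean_def choice_weight_def UNIV_bool sum_divide_distrib add_divide_distrib add.commute)
qed

lemma choice_mean_add_const:
  "choice_mean \<tau> (\<lambda>j c. a + \<phi> j c) = a + choice_mean \<tau> (\<phi> :: 'd::finite \<Rightarrow> bool \<Rightarrow> real)"
proof -
  have "(1 - \<tau>) * (a + x) + \<tau> * (a + y) = a + ((1 - \<tau>) * x + \<tau> * y)" for x y :: real
    by (simp add: algebra_simps)
  then show ?thesis by (simp add: choice_mean_def sum.distrib[of "\<lambda>_. a"] add_divide_distrib)
qed

lemma choices_eq_iff:
  "length ys = n \<Longrightarrow> choices i b n \<omega> = ys \<longleftrightarrow> (\<forall>k<n. i k \<omega> = fst (ys ! k) \<and> b k \<omega> = snd (ys ! k))"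
  by (auto simp: choices_def list_eq_iff_nth_eq prod_eq_iff)

text \<open>A history fixes every coordinate and every coin separately, so its event is an
  intersection over the jointly independent family and its probability factors.\<close>

lemma
  fixes i :: "nat \<Rightarrow> 's \<Rightarrow> 'd::finite"
  assumes ch: "coord_es_choices M K \<tau> i b" and n: "n \<le> K" and ys: "length ys = n"
  shows choices_event: "{\<omega>\<in>space M. choices i b n \<omega> = ys} \<in> sets M" (is ?E)
    and prob_choices: "measure M {\<omega>\<in>space M. choices i b n \<omega> = ys} = prod_list (map (choice_weight \<tau>) ys)" (is ?P)
proof -
  let ?X = "case_sum (\<lambda>k \<omega>. Inl (i k \<omega>)) (\<lambda>k \<omega>. Inr (b k \<omega>)) :: nat + nat \<Rightarrow> 's \<Rightarrow> 'd + bool"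
  let ?A = "case_sum (\<lambda>k. {Inl (fst (ys ! k))}) (\<lambda>k. {Inr (snd (ys ! k))}) :: nat + nat \<Rightarrow> ('d + bool) set"
  let ?J = "{..<n} <+> {..<n}"
  interpret prob_space M using ch by (simp add: coord_es_choices_def)
  have indep: "indep_vars (\<lambda>_. count_space UNIV) ?X ({..<K} <+> {..<K})"
    and pi: "\<And>k j. k < K \<Longrightarrow> prob {\<omega>\<in>space M. i k \<omega> = j} = 1 / real CARD('d)"
    and pb: "\<And>k. k < K \<Longrightarrow> prob {\<omega>\<in>space M. b k \<omega>} = 1 - \<tau>"
    using ch by (auto simp: coord_es_choices_def)
  have meas: "?X m \<in> measurable M (count_space UNIV)" if "m \<in> {..<K} <+> {..<K}" for m
    using indep that unfolding indep_vars_def by blast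
  have J: "?J \<subseteq> {..<K} <+> {..<K}" using n by auto
  \<comment> \<open>The case \<open>n = 0\<close> is separate, because the empty intersection is
    \<open>UNIV\<close> instead of \<open>space M\<close>.\<close>
  have eq: "{\<omega>\<in>space M. choices i b n \<omega> = ys} = (\<Inter>m\<in>?J. ?X m -` ?A m \<inter> space M)" if "n > 0"
    using that ys by (auto simp: choices_eq_iff Plus_def ball_Un)
  have ev: "?X m -` B \<inter> space M \<in> sets M" if "m \<in> {..<K} <+> {..<K}" for m B
    using meas[OF that] by (rule measurable_sets) simp
  show ?E
  proof (cases "n = 0")
    case False
    have "(\<Inter>m\<in>?J. ?X m -` ?A m \<inter> space M) \<in> sets M"
      using False J by (intro sets.finite_INT) (auto intro!: ev)
    then show ?thesis using eq False by simp
  qed (use ys in \<open>simp add: choices_def\<close>)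
  have pl: "prob (?X (Inl k) -` ?A (Inl k) \<inter> space M) = 1 / real CARD('d)" if "k < n" for k
    using pi[of k "fst (ys ! k)"] that n by (simp add: vimage_def Int_def conj_commute)
  have pr: "prob (?X (Inr k) -` ?A (Inr k) \<inter> space M) = (if snd (ys ! k) then 1 - \<tau> else \<tau>)"
    if "k < n" for k
  proof (cases "snd (ys ! k)")
    case True
    then show ?thesis using pb[of k] that n by (simp add: vimage_def Int_def conj_commute)
  next
    case False
    have T: "{\<omega>\<in>space M. b k \<omega>} \<in> sets M"
      using ev[OF InrI, of k "{Inr True}"] that n by (simp add: vimage_def Int_def conj_commute)
    \<comment> \<open>Only the probability of \<open>True\<close> is given; that of
      \<open>False\<close> is obtained from the complement.\<close>
    have "?X (Inr k) -` ?A (Inr k) \<inter> space M = space M - {\<omega>\<in>space M. b k \<omega>}"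
      using False by auto
    then show ?thesis using prob_compl[OF T] pb[of k] that n False by simp
  qed
  show ?P
  proof (cases "n = 0")
    case False
    have "prob {\<omega>\<in>space M. choices i b n \<omega> = ys} = (\<Prod>m\<in>?J. prob (?X m -` ?A m \<inter> space M))"
      unfolding eq[OF False[folded neq0_conv, simplified]] using False J
      by (intro indep_varsD[OF indep]) auto
    also have "\<dots> = (\<Prod>k<n. 1 / real CARD('d)) * (\<Prod>k<n. if snd (ys ! k) then 1 - \<tau> else \<tau>)"
      using pl pr by (subst prod.Plus) (auto simp del: prod_constant intro!: arg_cong2[of _ _ _ _ "(*)"] prod.cong)
    also have "\<dots> = (\<Prod>k<n. choice_weight \<tau> (ys ! k))"
      unfolding prod.distrib[symmetric] by (intro prod.cong) (auto simp: choice_weight_def)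
    also have "\<dots> = prod_list (map (choice_weight \<tau>) ys)"
      using ys by (simp add: prod.list_conv_set_nth atLeast0LessThan)
    finally show ?thesis .
  qed (use ys prob_space in \<open>simp add: choices_def\<close>)
qed

text \<open>A function of the history is a finite combination of indicators of histories, hence
  integrable with the evident integral.\<close>

lemma
  fixes f :: "('d::finite \<times> bool) list \<Rightarrow> real"
  assumes ch: "coord_es_choices M K \<tau> i b" and n: "n \<le> K"
  shows integrable_choices: "integrable M (\<lambda>\<omega>. f (choices i b n \<omega>))"
    and expectation_choices: "integral\<^sup>L M (\<lambda>\<omega>. f (choices i b n \<omega>))
          = (\<Sum>ys | length ys = n. prod_list (map (choice_weight \<tau>) ys) * f ys)"
proof -
  interpret prob_space M using ch by (simp add: coord_es_choices_def)
  let ?E = "\<lambda>ys. {\<omega>\<in>space M. choices i b n \<omega> = ys}"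
  let ?g = "\<lambda>\<omega>. \<Sum>ys | length ys = n. f ys * indicator (?E ys) \<omega>"
  have fin: "finite {ys :: ('d \<times> bool) list. length ys = n}"
    using finite_lists_length_eq[of "UNIV :: ('d \<times> bool) set" n] by simp
  have eq: "f (choices i b n \<omega>) = ?g \<omega>" if "\<omega> \<in> space M" for \<omega>
  proof -
    have "?g \<omega> = (\<Sum>ys | length ys = n. if choices i b n \<omega> = ys then f ys else 0)"
      using that by (intro sum.cong) (auto simp: indicator_def)
    also have "\<dots> = f (choices i b n \<omega>)"
      using fin by (simp add: choices_def)
    finally show ?thesis by simp
  qed
  have int: "integrable M (\<lambda>\<omega>. f ys * indicator (?E ys) \<omega>)" if "length ys = n" for ys
    using choices_event[OF ch n that]
    by (intro integrable_mult_right integrable_real_indicator) (auto simp: emeasure_eq_measure)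
  then have "integrable M ?g" by (intro Bochner_Integration.integrable_sum) auto
  then show "integrable M (\<lambda>\<omega>. f (choices i b n \<omega>))"
    using eq by (subst Bochner_Integration.integrable_cong[of M M _ ?g]) auto
  have "integral\<^sup>L M (\<lambda>\<omega>. f (choices i b n \<omega>)) = integral\<^sup>L M ?g"
    using eq by (intro Bochner_Integration.integral_cong) auto
  also have "\<dots> = (\<Sum>ys | length ys = n. integral\<^sup>L M (\<lambda>\<omega>. f ys * indicator (?E ys) \<omega>))"
    using int by (intro Bochner_Integration.integral_sum) auto
  also have "\<dots> = (\<Sum>ys | length ys = n. prod_list (map (choice_weight \<tau>) ys) * f ys)"
    using choices_event[OF ch n] prob_choices[OF ch n] by (intro sum.cong) auto
  finally show "integral\<^sup>L M (\<lambda>\<omega>. f (choices i b n \<omega>))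
          = (\<Sum>ys | length ys = n. prod_list (map (choice_weight \<tau>) ys) * f ys)" .
qed

text \<open>Tower property: weights multiply under appending, so the last entry of the list can be
  summed out first.\<close>

lemma expectation_choices_Suc:
  fixes f :: "('d::finite \<times> bool) list \<Rightarrow> real"
  assumes ch: "coord_es_choices M K \<tau> i b" and n: "n < K"
  shows "integral\<^sup>L M (\<lambda>\<omega>. f (choices i b (Suc n) \<omega>))
       = integral\<^sup>L M (\<lambda>\<omega>. choice_mean \<tau> (\<lambda>j c. f (choices i b n \<omega> @ [(j, c)])))"
proof -
  let ?W = "\<lambda>ys. prod_list (map (choice_weight \<tau>) ys)"
  have "integral\<^sup>L M (\<lambda>\<omega>. f (choices i b (Suc n) \<omega>)) = (\<Sum>ys | length ys = Suc n. ?W ys * f ys)"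
    using expectation_choices[OF ch, of "Suc n" f] n by simp
  also have "\<dots> = (\<Sum>(ys, x)\<in>{ys. length ys = n} \<times> UNIV. ?W (ys @ [x]) * f (ys @ [x]))"
    by (rule sum.reindex_bij_witness[of _ "\<lambda>(ys, x). ys @ [x]" "\<lambda>ys. (butlast ys, last ys)"])
      (auto simp: length_Suc_conv_rev)
  also have "\<dots> = (\<Sum>ys | length ys = n. ?W ys * choice_mean \<tau> (\<lambda>j c. f (ys @ [(j, c)])))"
    unfolding choice_mean_eq_sum
    by (simp add: sum.cartesian_product[symmetric] sum_distrib_left mult.assoc)
  also have "\<dots> = integral\<^sup>L M (\<lambda>\<omega>. choice_mean \<tau> (\<lambda>j c. f (choices i b n \<omega> @ [(j, c)])))"
    using expectation_choices[OF ch, of n "\<lambda>ys. choice_mean \<tau> (\<lambda>j c. f (ys @ [(j, c)]))"] n by simp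
  finally show ?thesis .
qed

text \<open>The state is a deterministic fold over the history, so everything transfers from
  \<open>choices\<close> for arbitrary \<open>step\<close> and \<open>\<Phi>\<close>, with no
  measurability condition on them.\<close>

lemma
  fixes i :: "nat \<Rightarrow> 's \<Rightarrow> 'd::finite" and \<Phi> :: "'a \<Rightarrow> real"
  assumes ch: "coord_es_choices M K \<tau> i b"
    and s0: "\<And>\<omega>. \<omega> \<in> space M \<Longrightarrow> s 0 \<omega> = s0"
    and s: "\<And>\<omega> k. \<omega> \<in> space M \<Longrightarrow> k < K \<Longrightarrow> s (Suc k) \<omega> = step (s k \<omega>) (i k \<omega>) (b k \<omega>)"
  shows chain_integrable: "n \<le> K \<Longrightarrow> integrable M (\<lambda>\<omega>. \<Phi> (s n \<omega>))"
    and chain_expectation_Suc: "n < K \<Longrightarrow> integral\<^sup>L M (\<lambda>\<omega>. \<Phi> (s (Suc n) \<omega>))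
      = integral\<^sup>L M (\<lambda>\<omega>. choice_mean \<tau> (\<lambda>j c. \<Phi> (step (s n \<omega>) j c)))"
proof -
  define st where "st = foldl (\<lambda>s x. step s (fst x) (snd x)) s0"
  have st: "s n \<omega> = st (choices i b n \<omega>)" if "n \<le> K" "\<omega> \<in> space M" for n \<omega>
    using that
  proof (induction n)
    case 0
    then show ?case by (simp add: s0 st_def choices_def)
  next
    case (Suc n)
    then show ?case by (simp add: s st_def choices_def)
  qed
  show "integrable M (\<lambda>\<omega>. \<Phi> (s n \<omega>))" if "n \<le> K"
    using integrable_choices[OF ch that, of "\<lambda>ys. \<Phi> (st ys)"] st that
    by (simp cong: Bochner_Integration.integrable_cong)
  show "integral\<^sup>L M (\<lambda>\<omega>. \<Phi> (s (Suc n) \<omega>))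
      = integral\<^sup>L M (\<lambda>\<omega>. choice_mean \<tau> (\<lambda>j c. \<Phi> (step (s n \<omega>) j c)))" if "n < K"
    using expectation_choices_Suc[OF ch that, of "\<lambda>ys. \<Phi> (st ys)"] st that
    by (simp add: st_def cong: Bochner_Integration.integral_cong)
qed

text \<open>Discrete Gronwall argument: the one-step bound is averaged and iterated. The invariant
  \<open>I\<close> restricts the drift condition to states the chain can reach.\<close>

lemma chain_drift:
  fixes i :: "nat \<Rightarrow> 's \<Rightarrow> 'd::finite" and \<Phi> :: "'a \<Rightarrow> real"
  assumes ch: "coord_es_choices M K \<tau> i b"
    and s0: "\<And>\<omega>. \<omega> \<in> space M \<Longrightarrow> s 0 \<omega> = s0"
    and s: "\<And>\<omega> k. \<omega> \<in> space M \<Longrightarrow> k < K \<Longrightarrow> s (Suc k) \<omega> = step (s k \<omega>) (i k \<omega>) (b k \<omega>)"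
    and I: "I s0" "\<And>x j c. I x \<Longrightarrow> I (step x j c)"
    and drift: "\<And>x. I x \<Longrightarrow> choice_mean \<tau> (\<lambda>j c. \<Phi> (step x j c)) \<le> a * \<Phi> x + e"
    and "0 \<le> a" and "n \<le> K"
  shows "integral\<^sup>L M (\<lambda>\<omega>. \<Phi> (s n \<omega>)) \<le> a ^ n * \<Phi> s0 + e * (\<Sum>k<n. a ^ k)"
  using \<open>n \<le> K\<close>
proof (induction n)
  case 0
  interpret prob_space M using ch by (simp add: coord_es_choices_def)
  have "integral\<^sup>L M (\<lambda>\<omega>. \<Phi> (s 0 \<omega>)) = integral\<^sup>L M (\<lambda>\<omega>. \<Phi> s0)"
    by (intro Bochner_Integration.integral_cong) (auto simp: s0)
  then show ?case by (simp add: prob_space)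
next
  case (Suc n)
  interpret prob_space M using ch by (simp add: coord_es_choices_def)
  have inv: "I (s k \<omega>)" if "k \<le> K" "\<omega> \<in> space M" for k \<omega>
    using that by (induction k) (auto simp: s0 s I)
  have "integral\<^sup>L M (\<lambda>\<omega>. \<Phi> (s (Suc n) \<omega>))
      = integral\<^sup>L M (\<lambda>\<omega>. choice_mean \<tau> (\<lambda>j c. \<Phi> (step (s n \<omega>) j c)))"
    using Suc.prems by (intro chain_expectation_Suc[OF ch s0 s]) auto
  also have "\<dots> \<le> integral\<^sup>L M (\<lambda>\<omega>. a * \<Phi> (s n \<omega>) + e)"
    using Suc.prems inv drift
    by (intro integral_mono chain_integrable[OF ch s0 s, where \<Phi> = "\<lambda>x. choice_mean \<tau> (\<lambda>j c. \<Phi> (step x j c))"]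
        chain_integrable[OF ch s0 s, where \<Phi> = "\<lambda>x. a * \<Phi> x + e"]) auto
  also have "\<dots> = a * integral\<^sup>L M (\<lambda>\<omega>. \<Phi> (s n \<omega>)) + e"
    using chain_integrable[OF ch s0 s, where \<Phi> = \<Phi> and n = n] Suc.prems by (simp add: prob_space)
  also have "\<dots> \<le> a * (a ^ n * \<Phi> s0 + e * (\<Sum>k<n. a ^ k)) + e"
    using Suc \<open>0 \<le> a\<close> by (intro add_mono mult_left_mono) auto
  also have "\<dots> = a ^ Suc n * \<Phi> s0 + e * (\<Sum>k<Suc n. a ^ k)"
    unfolding sum.lessThan_Suc_shift by (simp add: algebra_simps sum_distrib_left)
  finally show ?case .
qed

subsection \<open>One step of Coord-ES\<close>

text \<open>Were \<open>h zs\<close> infinite, the inequality tested at a point with finite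
  \<open>h\<close> would have left-hand side \<open>-\<infinity>\<close>.\<close>

lemma solution_in_edom:
  assumes "proper_fun h" "edom h \<subseteq> Z" "solves_VI Z F h zs"
  shows "zs \<in> edom h"
proof (rule ccontr)
  assume "zs \<notin> edom h"
  then have "h zs = \<infinity>" by (simp add: edom_def)
  moreover obtain x a where x: "h x = ereal a" using proper_fun_finite_valueE[OF assms(1)] .
  moreover have "x \<in> Z" using x assms(2) by (auto simp: edom_def)
  ultimately show False using assms(3) by (auto simp: solves_VI_def)
qed

text \<open>On the domain of \<open>h\<close> the variational inequality is the subgradient
  inequality for \<open>- F zs\<close>; off the domain the latter is trivial.\<close>

lemma VI_subdifferential:
  assumes "proper_fun h" "edom h \<subseteq> Z" "solves_VI Z F h zs"
  shows "- F zs \<in> subdifferential h zs"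
proof -
  have zs: "zs \<in> edom h" by (rule solution_in_edom[OF assms])
  then obtain a where a: "h zs = ereal a" using proper_fun_edomE[OF assms(1)] by blast
  have "h zs + ereal (inner (- F zs) (y - zs)) \<le> h y" for y
  proof (cases "y \<in> edom h")
    case True
    then obtain c where "h y = ereal c" using proper_fun_edomE[OF assms(1)] by blast
    moreover have "ereal (inner (F zs) (y - zs)) + h y - h zs \<ge> 0"
      using True assms(2,3) by (auto simp: solves_VI_def)
    ultimately show ?thesis using a by simp
  qed (simp add: edom_def)
  then show ?thesis using zs by (simp add: subdifferential_def)
qed

text \<open>Adding the two strong monotonicity inequalities, with \<open>- F zs\<close> as the
  subgradient of \<open>h\<close> at \<open>zs\<close>, cancels the terms in
  \<open>F zs\<close>.\<close>

lemma strongly_monotone_VI_lower_bound: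
  assumes "proper_fun h" "edom h \<subseteq> Z" "solves_VI Z F h zs"
    and sm: "strongly_monotone Z F h \<mu>F \<mu>h" and "0 \<le> \<mu>F" "x \<in> edom h"
  shows "(\<mu>F + \<mu>h / 2) * (norm (x - zs))\<^sup>2
       \<le> inner (F x) (x - zs) + real_of_ereal (h x) - real_of_ereal (h zs)"
proof -
  have zs: "zs \<in> edom h" by (rule solution_in_edom[OF assms(1-3)])
  obtain a where a: "h zs = ereal a" using proper_fun_edomE[OF assms(1) zs] .
  obtain c where c: "h x = ereal c" using proper_fun_edomE[OF assms(1,6)] .
  have Z: "zs \<in> Z" "x \<in> Z" using zs assms(2,6) by auto
  then have "inner (F x - F zs) (x - zs) \<ge> \<mu>F * (norm (x - zs))\<^sup>2"
    and "h x - h zs - ereal (inner (- F zs) (x - zs)) \<ge> ereal (\<mu>h / 2 * (norm (x - zs))\<^sup>2)"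
    using sm VI_subdifferential[OF assms(1-3)] unfolding strongly_monotone_def by blast+
  then show ?thesis using a c by (simp add: inner_diff_left algebra_simps)
qed

section \<open>The unbiased coordinate estimator and its moments\<close>

definition coord_est :: "real^'d::finite \<Rightarrow> 'd \<Rightarrow> real^'d" where
  "coord_est v j = (real CARD('d) * v $ j) *\<^sub>R axis j 1"

lemma sum_coord_est: "(\<Sum>j\<in>UNIV. coord_est v j) = real CARD('d) *\<^sub>R (v :: real^'d::finite)"
proof -
  have "(\<Sum>j\<in>UNIV. v $ j *\<^sub>R axis j (1::real)) = v"
    using basis_expansion[of v] by (simp add: scalar_mult_eq_scaleR)
  then show ?thesis unfolding coord_est_def by (simp flip: scaleR_scaleR scaleR_sum_right)
qed

lemma sum_norm_coord_est:
  "(\<Sum>j\<in>UNIV. (norm (coord_est v j))\<^sup>2) = (real CARD('d))\<^sup>2 * (norm (v :: real^'d::finite))\<^sup>2"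
  by (simp add: coord_est_def power_mult_distrib norm_vec_def[of v] L2_set_def sum_nonneg norm_axis_1 flip: sum_distrib_left)

lemma coord_est_average:
  fixes v a :: "real^'d::finite"
  shows "(\<Sum>j\<in>UNIV. c + inner (coord_est v j) a + t * (norm (coord_est v j))\<^sup>2) / real CARD('d)
    = c + inner v a + t * real CARD('d) * (norm v)\<^sup>2"
  by (simp add: sum.distrib sum_norm_coord_est sum_coord_est add_divide_distrib
      flip: sum_distrib_left inner_sum_left) (simp add: power2_eq_square)

text \<open>Reduces a bound in the mean to one for each coordinate: after the coin is averaged,
  \<open>j\<close> enters only linearly in the estimator and through its squared norm, so two
  moments suffice.\<close>

lemma choice_mean_le_coord_est:
  fixes v a :: "real^'d::finite"
  assumes "\<And>j. (1 - \<tau>) * \<phi> j True + \<tau> * \<phi> j False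
      \<le> c + inner (coord_est v j) a + t * (norm (coord_est v j))\<^sup>2"
  shows "choice_mean \<tau> \<phi> \<le> c + inner v a + t * real CARD('d) * (norm v)\<^sup>2"
  unfolding choice_mean_def coord_est_average[symmetric]
  by (intro divide_right_mono sum_mono assms) auto

definition es_half :: "real \<Rightarrow> real \<Rightarrow> ('a \<Rightarrow> 'a) \<Rightarrow> ('a \<Rightarrow> ereal) \<Rightarrow> 'a \<Rightarrow> 'a \<Rightarrow> 'a::real_normed_vector" where
  "es_half \<tau> \<gamma> F h z w = prox \<gamma> h (\<tau> *\<^sub>R z + (1 - \<tau>) *\<^sub>R w - \<gamma> *\<^sub>R F w)"

text \<open>The two coordinate terms of the iteration are merged into one estimator of the
  difference of \<open>F\<close>, by linearity of \<open>coord_est\<close> in its vector.\<close>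

definition es_next :: "real \<Rightarrow> real \<Rightarrow> (real^'d \<Rightarrow> real^'d) \<Rightarrow> (real^'d \<Rightarrow> ereal) \<Rightarrow>
    real^'d \<Rightarrow> real^'d \<Rightarrow> 'd \<Rightarrow> real^'d::finite" where
  "es_next \<tau> \<gamma> F h z w j = prox \<gamma> h (\<tau> *\<^sub>R z + (1 - \<tau>) *\<^sub>R w
     - \<gamma> *\<^sub>R (coord_est (F (es_half \<tau> \<gamma> F h z w) - F w) j + F w))"

text \<open>The two displacements of \<open>a\<close> have mean zero under the weights
  \<open>1 - \<tau>\<close> and \<open>\<tau>\<close>, so only the variance of the coin is
  added.\<close>

lemma mean_square_centered:
  fixes a p :: "'a::real_inner"
  shows "(1 - \<tau>) * (norm (a - \<tau> *\<^sub>R p))\<^sup>2 + \<tau> * (norm (a + (1 - \<tau>) *\<^sub>R p))\<^sup>2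
    = (norm a)\<^sup>2 + \<tau> * (1 - \<tau>) * (norm p)\<^sup>2"
  unfolding power2_norm_eq_inner by (simp add: inner_simps inner_commute algebra_simps power2_eq_square)

lemma norm_add_square_le:
  fixes a b :: "'a::real_inner"
  shows "(norm (a + b))\<^sup>2 \<le> 2 * (norm a)\<^sup>2 + 2 * (norm b)\<^sup>2"
proof -
  have "0 \<le> (norm (a - b))\<^sup>2" by simp
  then show ?thesis unfolding power2_norm_eq_inner by (simp add: inner_simps inner_commute)
qed

text \<open>The increments of the processes \<open>S\<close> and \<open>Y\<close>: random increments linear in \<open>u\<close> go into the noise,
  those not depending on \<open>u\<close> into the excess.\<close>

definition es_noise :: "real \<Rightarrow> real \<Rightarrow> (real^'d \<Rightarrow> real^'d) \<Rightarrow> (real^'d \<Rightarrow> ereal) \<Rightarrow>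
    real^'d \<Rightarrow> real^'d \<Rightarrow> 'd \<Rightarrow> bool \<Rightarrow> real^'d::finite" where
  "es_noise \<tau> \<gamma> F h z w j c =
     ((1 - \<tau>) - of_bool c) *\<^sub>R (es_next \<tau> \<gamma> F h z w j - w)
     + \<gamma> *\<^sub>R (coord_est (F (es_half \<tau> \<gamma> F h z w) - F w) j - (F (es_half \<tau> \<gamma> F h z w) - F w))"

definition es_excess :: "real \<Rightarrow> real \<Rightarrow> (real^'d \<Rightarrow> real^'d) \<Rightarrow> (real^'d \<Rightarrow> ereal) \<Rightarrow> real^'d \<Rightarrow>
    real^'d \<Rightarrow> real^'d \<Rightarrow> 'd \<Rightarrow> bool \<Rightarrow> real" where
  "es_excess \<tau> \<gamma> F h z0 z w j c =
     (let zh = es_half \<tau> \<gamma> F h z w; zp = es_next \<tau> \<gamma> F h z w j; v = F zh - F w in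
      (of_bool c - (1 - \<tau>)) * ((norm (zp - z0))\<^sup>2 - (norm (w - z0))\<^sup>2)
      + 2 * \<gamma> * inner (v - coord_est v j) (zh - z0)
      - (1 - \<tau>) * (norm (w - zh))\<^sup>2 + \<gamma>\<^sup>2 * (norm (coord_est v j))\<^sup>2)"

section \<open>Pathwise one-step inequalities\<close>

context
  fixes h :: "real^'d::finite \<Rightarrow> ereal" and F :: "real^'d \<Rightarrow> real^'d" and \<gamma> :: real
  assumes h: "proper_fun h" "lower_semicontinuous h" "econvex h" and \<gamma>: "0 < \<gamma>"
begin

lemma es_half_in_edom: "es_half \<tau> \<gamma> F h z w \<in> edom h"
  unfolding es_half_def by (rule prox_in_edom[OF h \<gamma>])

lemma es_next_in_edom: "es_next \<tau> \<gamma> F h z w j \<in> edom h"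
  unfolding es_next_def by (rule prox_in_edom[OF h \<gamma>])

lemma es_next_inequality:
  fixes z w u :: "real^'d" and \<tau> :: real
  assumes "u \<in> edom h"
  defines "zh \<equiv> es_half \<tau> \<gamma> F h z w"
  defines "v \<equiv> F zh - F w"
  shows "(norm (es_next \<tau> \<gamma> F h z w j - u))\<^sup>2 \<le> \<tau> * (norm (z - u))\<^sup>2 + (1 - \<tau>) * (norm (w - u))\<^sup>2
      - (1 - \<tau>) * (norm (w - zh))\<^sup>2 - \<tau> * (norm (z - zh))\<^sup>2 + \<gamma>\<^sup>2 * (norm (coord_est v j))\<^sup>2
      - 2 * \<gamma> * (inner (F w + coord_est v j) (zh - u) + real_of_ereal (h zh) - real_of_ereal (h u))"
  using extragradient_step[OF h \<gamma> assms(1), where \<tau> = \<tau> and z = z and w = w and g = "F w" and e = "coord_est v j"]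
  unfolding v_def zh_def es_next_def es_half_def .

lemma es_next_es_half_distance:
  "(norm (es_next \<tau> \<gamma> F h z w j - es_half \<tau> \<gamma> F h z w))\<^sup>2
     \<le> \<gamma>\<^sup>2 * (norm (coord_est (F (es_half \<tau> \<gamma> F h z w) - F w) j))\<^sup>2"
  using prox_step_distance[OF h \<gamma>, of "\<tau> *\<^sub>R z + (1 - \<tau>) *\<^sub>R w - \<gamma> *\<^sub>R F w"
      "coord_est (F (es_half \<tau> \<gamma> F h z w) - F w) j"]
  unfolding es_next_def es_half_def by (simp add: algebra_simps)

text \<open>Holds for each outcome of coordinate and coin, so \<open>u\<close> may later depend on
  the sample. Monotonicity replaces \<open>F zh\<close> by \<open>F u\<close>; deviations from the
  mean are gathered in \<open>es_noise\<close> and \<open>es_excess\<close>, relative to the fixed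
  point \<open>z0\<close>.\<close>

lemma es_gap_step:
  fixes z w u :: "real^'d" and j :: 'd and \<tau> :: real
  assumes "u \<in> edom h" and Z: "edom h \<subseteq> Z" and \<tau>: "0 \<le> \<tau>"
    and mono: "strongly_monotone Z F h 0 0"
  defines "zh \<equiv> es_half \<tau> \<gamma> F h z w" and "zp \<equiv> es_next \<tau> \<gamma> F h z w j"
  shows "2 * \<gamma> * (inner (F u) (zh - u) + real_of_ereal (h zh) - real_of_ereal (h u))
     \<le> (\<tau> * (norm (z - u))\<^sup>2 + (norm (w - u))\<^sup>2)
       - (\<tau> * (norm (zp - u))\<^sup>2 + (norm ((if c then zp else w) - u))\<^sup>2)
       + 2 * inner (es_noise \<tau> \<gamma> F h z w j c) (u - z0) + es_excess \<tau> \<gamma> F h z0 z w j c"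
proof -
  define v where "v = F zh - F w"
  define \<Delta> where "\<Delta> = coord_est v j"
  define r where "r = real_of_ereal (h zh) - real_of_ereal (h u)"
  define \<beta> where "\<beta> = of_bool c - (1 - \<tau>)"
  have "zh \<in> Z" "u \<in> Z" using es_half_in_edom[where z = z and w = w and \<tau> = \<tau>] assms(1) Z by (auto simp: zh_def)
  then have "0 * (norm (zh - u))\<^sup>2 \<le> inner (F zh - F u) (zh - u)"
    using mono unfolding strongly_monotone_def by blast
  then have 1: "2 * \<gamma> * (inner (F u) (zh - u) + r) \<le> 2 * \<gamma> * (inner (F zh) (zh - u) + r)"
    using \<gamma> by (intro mult_left_mono) (auto simp: inner_diff_left)
  have 2: "(norm (zp - u))\<^sup>2 \<le> \<tau> * (norm (z - u))\<^sup>2 + (1 - \<tau>) * (norm (w - u))\<^sup>2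
      - (1 - \<tau>) * (norm (w - zh))\<^sup>2 - \<tau> * (norm (z - zh))\<^sup>2 + \<gamma>\<^sup>2 * (norm \<Delta>)\<^sup>2
      - 2 * \<gamma> * (inner (F w + \<Delta>) (zh - u) + r)"
    using es_next_inequality[OF assms(1), where z = z and w = w and j = j and \<tau> = \<tau>] by (simp add: zp_def zh_def \<Delta>_def v_def r_def add_diff_eq)
  have 3: "(norm ((if c then zp else w) - u))\<^sup>2
      = (1 - \<tau>) * (norm (zp - u))\<^sup>2 + \<tau> * (norm (w - u))\<^sup>2 + \<beta> * ((norm (zp - u))\<^sup>2 - (norm (w - u))\<^sup>2)"
    by (simp add: \<beta>_def algebra_simps)
  \<comment> \<open>A difference of squared distances is affine in \<open>u\<close>, so re-centring
    at \<open>z0\<close> leaves \<open>u\<close> only in one inner product.\<close>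
  have 4: "(norm (zp - u))\<^sup>2 - (norm (w - u))\<^sup>2
      = (norm (zp - z0))\<^sup>2 - (norm (w - z0))\<^sup>2 - 2 * inner (zp - w) (u - z0)"
    unfolding power2_norm_eq_inner by (simp add: inner_simps inner_commute algebra_simps)
  have 5: "es_excess \<tau> \<gamma> F h z0 z w j c = \<beta> * ((norm (zp - z0))\<^sup>2 - (norm (w - z0))\<^sup>2)
      + 2 * \<gamma> * inner (v - \<Delta>) (zh - z0) - (1 - \<tau>) * (norm (w - zh))\<^sup>2 + \<gamma>\<^sup>2 * (norm \<Delta>)\<^sup>2"
    by (simp add: es_excess_def Let_def zp_def zh_def \<Delta>_def v_def \<beta>_def)
  have 6: "inner (es_noise \<tau> \<gamma> F h z w j c) (u - z0) = - \<beta> * inner (zp - w) (u - z0) - \<gamma> * inner (v - \<Delta>) (u - z0)"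
    by (simp add: es_noise_def zp_def zh_def \<Delta>_def v_def \<beta>_def inner_simps algebra_simps)
  \<comment> \<open>Exchanging \<open>F zh\<close> for \<open>F w + \<Delta>\<close> costs the
    estimation error \<open>v - \<Delta>\<close>, again split at \<open>z0\<close> into a part
    without \<open>u\<close> and a part linear in \<open>u\<close>.\<close>
  have 7: "2 * \<gamma> * (inner (F zh) (zh - u) + r)
      = 2 * \<gamma> * (inner (F w + \<Delta>) (zh - u) + r) + 2 * \<gamma> * inner (v - \<Delta>) (zh - z0) - 2 * \<gamma> * inner (v - \<Delta>) (u - z0)"
    by (simp add: v_def inner_simps algebra_simps)
  have 8: "0 \<le> \<tau> * (norm (z - zh))\<^sup>2" using \<tau> by simp
  have "2 * \<gamma> * (inner (F u) (zh - u) + r)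
     \<le> (\<tau> * (norm (z - u))\<^sup>2 + (norm (w - u))\<^sup>2)
       - (\<tau> * (norm (zp - u))\<^sup>2 + (norm ((if c then zp else w) - u))\<^sup>2)
       + 2 * inner (es_noise \<tau> \<gamma> F h z w j c) (u - z0) + es_excess \<tau> \<gamma> F h z0 z w j c"
  proof -
    define A B C I X Y T where "A = (norm (zp - u))\<^sup>2" and "B = (norm (w - u))\<^sup>2"
      and "C = (norm (zp - z0))\<^sup>2 - (norm (w - z0))\<^sup>2" and "I = inner (zp - w) (u - z0)"
      and "X = inner (v - \<Delta>) (zh - z0)" and "Y = inner (v - \<Delta>) (u - z0)"
      and "T = 2 * \<gamma> * (inner (F w + \<Delta>) (zh - u) + r)"
    note defs = this
    have "A - B = C - 2 * I" using 4 unfolding defs .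
    then have "\<beta> * (A - B) = \<beta> * C - 2 * (\<beta> * I)"
      by (simp add: right_diff_distrib)
    with 1 2 8 show ?thesis
      unfolding 3 5 6 7 defs[symmetric] by (simp add: algebra_simps)
  qed
  then show ?thesis by (simp add: r_def algebra_simps)
qed

end

section \<open>One-step drift in the mean\<close>

context
  fixes h :: "real^'d::finite \<Rightarrow> ereal" and F :: "real^'d \<Rightarrow> real^'d" and Z :: "(real^'d) set"
    and \<tau> \<gamma> L D :: real
  assumes h: "proper_fun h" "lower_semicontinuous h" "econvex h" and \<gamma>: "0 < \<gamma>"
    and Z: "edom h \<subseteq> Z" and \<tau>: "0 \<le> \<tau>" "\<tau> < 1" and lip: "boundedly_Lipschitz Z F L D"
begin

lemma F_variation_bound:
  assumes "w \<in> Z"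
  shows "(norm (F (es_half \<tau> \<gamma> F h z w) - F w))\<^sup>2 \<le> L\<^sup>2 * (norm (w - es_half \<tau> \<gamma> F h z w))\<^sup>2 + D\<^sup>2"
  using lip es_half_in_edom[OF h \<gamma>, where z = z and w = w and \<tau> = \<tau> and F = F] Z assms unfolding boundedly_Lipschitz_def
  by (metis norm_minus_commute subsetD)

text \<open>The one-step inequality at \<open>zs\<close> is averaged; the step size lets the
  negative distance terms absorb the Lipschitz part of the estimator's second moment and still pay
  for the contraction.\<close>

lemma strongly_monotone_drift:
  assumes VI: "solves_VI Z F h zs" and sm: "strongly_monotone Z F h \<mu>F \<mu>h"
    and \<mu>: "0 \<le> \<mu>F" "0 \<le> \<mu>h"
    and g1: "\<gamma>\<^sup>2 * (8 * real CARD('d) * L\<^sup>2) \<le> 1 - \<tau>" and g2: "\<gamma> * (4 * (\<mu>F + \<mu>h)) \<le> 1 - \<tau>"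
    and w: "w \<in> Z"
  shows "choice_mean \<tau> (\<lambda>j c. \<tau> * (norm (es_next \<tau> \<gamma> F h z w j - zs))\<^sup>2
       + (norm ((if c then es_next \<tau> \<gamma> F h z w j else w) - zs))\<^sup>2)
     \<le> (1 - \<gamma> * ((\<mu>F + \<mu>h) / 16)) * (\<tau> * (norm (z - zs))\<^sup>2 + (norm (w - zs))\<^sup>2)
       + \<gamma>\<^sup>2 * real CARD('d) * D\<^sup>2"
proof -
  define zh where "zh = es_half \<tau> \<gamma> F h z w"
  define v where "v = F zh - F w"
  define d where "d = real CARD('d)"
  define \<mu> where "\<mu> = \<mu>F + \<mu>h"
  define r where "r = real_of_ereal (h zh) - real_of_ereal (h zs)"
  define a where "a = (norm (z - zh))\<^sup>2"
  define q where "q = (norm (w - zh))\<^sup>2"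
  define p where "p = (norm (zh - zs))\<^sup>2"
  define V where "V = \<tau> * (norm (z - zs))\<^sup>2 + (norm (w - zs))\<^sup>2"
  have zs: "zs \<in> edom h" by (rule solution_in_edom[OF h(1) Z VI])
  have pos: "0 \<le> a" "0 \<le> q" "0 \<le> p" by (simp_all add: a_def q_def p_def)
  have "choice_mean \<tau> (\<lambda>j c. \<tau> * (norm (es_next \<tau> \<gamma> F h z w j - zs))\<^sup>2
       + (norm ((if c then es_next \<tau> \<gamma> F h z w j else w) - zs))\<^sup>2)
     \<le> (V - (1 - \<tau>) * q - \<tau> * a - 2 * \<gamma> * (inner (F w) (zh - zs) + r))
       + inner v (- (2 * \<gamma>) *\<^sub>R (zh - zs)) + \<gamma>\<^sup>2 * real CARD('d) * (norm v)\<^sup>2"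
  proof (rule choice_mean_le_coord_est)
    fix j
    \<comment> \<open>With \<open>A\<close> and \<open>B\<close> the squared distances of the full
      step and of \<open>w\<close> to \<open>zs\<close>, the weight \<open>\<tau>\<close> makes the
      mean contain \<open>A\<close> with coefficient exactly 1.\<close>
    have "(1 - \<tau>) * (\<tau> * A + A) + \<tau> * (\<tau> * A + B) = A + \<tau> * B" for A B :: real
      by (simp add: algebra_simps)
    with es_next_inequality[OF h \<gamma> zs, where z = z and w = w and j = j and \<tau> = \<tau> and F = F, folded zh_def, folded v_def]
    show "(1 - \<tau>) * (\<tau> * (norm (es_next \<tau> \<gamma> F h z w j - zs))\<^sup>2
          + (norm ((if True then es_next \<tau> \<gamma> F h z w j else w) - zs))\<^sup>2)
        + \<tau> * (\<tau> * (norm (es_next \<tau> \<gamma> F h z w j - zs))\<^sup>2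
          + (norm ((if False then es_next \<tau> \<gamma> F h z w j else w) - zs))\<^sup>2)
        \<le> (V - (1 - \<tau>) * q - \<tau> * a - 2 * \<gamma> * (inner (F w) (zh - zs) + r))
          + inner (coord_est v j) (- (2 * \<gamma>) *\<^sub>R (zh - zs)) + \<gamma>\<^sup>2 * (norm (coord_est v j))\<^sup>2"
      unfolding V_def a_def q_def r_def by (simp add: algebra_simps inner_add_left)
  qed
  also have "\<dots> = V - (1 - \<tau>) * q - \<tau> * a - 2 * \<gamma> * (inner (F zh) (zh - zs) + r) + \<gamma>\<^sup>2 * d * (norm v)\<^sup>2"
    by (simp add: v_def d_def algebra_simps inner_diff_left)
  \<comment> \<open>By \<open>g1\<close> the Lipschitz part costs at most an eighth of
    \<open>(1 - \<tau>) * q\<close>; strong monotonicity supplies the term in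
    \<open>p\<close>.\<close>
  also have "\<dots> \<le> V - (7 / 8) * (1 - \<tau>) * q - \<tau> * a - \<gamma> * \<mu> * p + \<gamma>\<^sup>2 * d * D\<^sup>2"
  proof -
    have "(\<mu>F + \<mu>h / 2) * p \<le> inner (F zh) (zh - zs) + r"
      using strongly_monotone_VI_lower_bound[OF h(1) Z VI sm \<mu>(1), of zh] es_half_in_edom[OF h \<gamma>]
      by (simp add: zh_def p_def r_def)
    moreover have "\<mu> / 2 * p \<le> (\<mu>F + \<mu>h / 2) * p"
      using \<mu> pos by (intro mult_right_mono) (auto simp: \<mu>_def)
    ultimately have "2 * \<gamma> * (\<mu> / 2 * p) \<le> 2 * \<gamma> * (inner (F zh) (zh - zs) + r)"
      using \<gamma> by (intro mult_left_mono) auto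
    moreover have "\<gamma>\<^sup>2 * d * (norm v)\<^sup>2 \<le> \<gamma>\<^sup>2 * d * (L\<^sup>2 * q + D\<^sup>2)"
      using F_variation_bound[OF w, of z] unfolding v_def zh_def q_def d_def
      by (intro mult_left_mono) auto
    moreover have "\<gamma>\<^sup>2 * (8 * d * L\<^sup>2) * q \<le> (1 - \<tau>) * q"
      using g1 pos by (intro mult_right_mono) (auto simp: d_def)
    ultimately show ?thesis by (simp add: algebra_simps add_divide_distrib diff_divide_distrib)
  qed
  \<comment> \<open>Splitting the distances to \<open>zs\<close> at \<open>zh\<close> gives
    \<open>V \<le> 2 * (\<tau> * a) + 2 * q + 4 * p\<close>; the factor \<open>1/16\<close> fits all
    three negative terms with room to spare.\<close>
  also have "\<dots> \<le> V - \<gamma> * (\<mu> / 16) * V + \<gamma>\<^sup>2 * d * D\<^sup>2"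
  proof -
    have gm: "0 \<le> \<gamma> * \<mu>" "4 * (\<gamma> * \<mu>) \<le> 1 - \<tau>" using \<mu> \<gamma> g2 by (auto simp: \<mu>_def algebra_simps)
    have "(norm (z - zs))\<^sup>2 \<le> 2 * a + 2 * p" "(norm (w - zs))\<^sup>2 \<le> 2 * q + 2 * p"
      using norm_add_square_le[of "z - zh" "zh - zs"] norm_add_square_le[of "w - zh" "zh - zs"]
      by (simp_all add: a_def q_def p_def)
    then have "V \<le> \<tau> * (2 * a + 2 * p) + (2 * q + 2 * p)"
      unfolding V_def using \<tau> by (intro add_mono mult_left_mono) auto
    also have "\<dots> \<le> 2 * (\<tau> * a) + 2 * q + 4 * p"
      using mult_right_mono[of \<tau> 1 p] \<tau> pos by (simp add: algebra_simps)
    finally have "\<gamma> * \<mu> * V \<le> \<gamma> * \<mu> * (2 * (\<tau> * a) + 2 * q + 4 * p)"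
      using gm by (intro mult_left_mono) auto
    moreover have "\<gamma> * \<mu> * (\<tau> * a) \<le> 1 * (\<tau> * a)"
      using gm \<tau> pos by (intro mult_right_mono) auto
    moreover have "4 * (\<gamma> * \<mu>) * q \<le> (1 - \<tau>) * q"
      using gm pos by (intro mult_right_mono) auto
    moreover have "0 \<le> \<gamma> * \<mu> * p" "0 \<le> \<tau> * a" "0 \<le> (1 - \<tau>) * q" using gm pos \<tau> by auto
    moreover have "\<gamma> * \<mu> * (2 * (\<tau> * a) + 2 * q + 4 * p)
        = 2 * (\<gamma> * \<mu> * (\<tau> * a)) + (1/2) * (4 * (\<gamma> * \<mu>) * q) + 4 * (\<gamma> * \<mu> * p)"
      by (simp add: algebra_simps)
    ultimately show ?thesis by (simp add: algebra_simps add_divide_distrib diff_divide_distrib)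
  qed
  finally show ?thesis unfolding V_def \<mu>_def d_def by (simp add: algebra_simps)
qed

text \<open>Both noise terms are centred given the past, so \<open>(norm S)\<^sup>2\<close> grows only by the conditional variance,
  which the term \<open>-(1 - \<tau>) * (norm (w - zh))\<^sup>2\<close> of the excess absorbs up to the \<open>D\<close> part.\<close>

lemma es_noise_drift:
  assumes g: "\<gamma>\<^sup>2 * (16 * real CARD('d) * L\<^sup>2) \<le> 1 - \<tau>" and w: "w \<in> Z"
  shows "choice_mean \<tau> (\<lambda>j c. es_excess \<tau> \<gamma> F h z0 z w j c
           + (norm (S + es_noise \<tau> \<gamma> F h z w j c))\<^sup>2 / 6)
     \<le> (norm S)\<^sup>2 / 6 + 3 / 2 * \<gamma>\<^sup>2 * real CARD('d) * D\<^sup>2"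
proof -
  define zh where "zh = es_half \<tau> \<gamma> F h z w"
  define v where "v = F zh - F w"
  define q where "q = (norm (w - zh))\<^sup>2"
  define N where "N = (norm v)\<^sup>2"
  have "0 \<le> q" "0 \<le> N" by (simp_all add: q_def N_def)
  have "choice_mean \<tau> (\<lambda>j c. es_excess \<tau> \<gamma> F h z0 z w j c
           + (norm (S + es_noise \<tau> \<gamma> F h z w j c))\<^sup>2 / 6)
     \<le> (2 * \<gamma> * inner v (zh - z0) - 2 / 3 * (1 - \<tau>) * q
          + ((norm S)\<^sup>2 - 2 * \<gamma> * inner v S + \<gamma>\<^sup>2 * N) / 6)
       + inner v (- (2 * \<gamma>) *\<^sub>R (zh - z0) + (\<gamma> / 3) *\<^sub>R S - (\<gamma>\<^sup>2 / 3) *\<^sub>R v)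
       + 3 / 2 * \<gamma>\<^sup>2 * real CARD('d) * (norm v)\<^sup>2"
  proof (rule choice_mean_le_coord_est)
    fix j
    define zp where "zp = es_next \<tau> \<gamma> F h z w j"
    define \<Delta> where "\<Delta> = coord_est v j"
    \<comment> \<open>\<open>e\<close> omits the coin part of the noise, so the two coin outcomes
      shift it by centred multiples of \<open>zp - w\<close>.\<close>
    define e where "e = S + \<gamma> *\<^sub>R (\<Delta> - v)"
    have exT: "es_excess \<tau> \<gamma> F h z0 z w j True = \<tau> * ((norm (zp - z0))\<^sup>2 - (norm (w - z0))\<^sup>2)
        + 2 * \<gamma> * inner (v - \<Delta>) (zh - z0) - (1 - \<tau>) * q + \<gamma>\<^sup>2 * (norm \<Delta>)\<^sup>2"
      and exF: "es_excess \<tau> \<gamma> F h z0 z w j False = - (1 - \<tau>) * ((norm (zp - z0))\<^sup>2 - (norm (w - z0))\<^sup>2)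
        + 2 * \<gamma> * inner (v - \<Delta>) (zh - z0) - (1 - \<tau>) * q + \<gamma>\<^sup>2 * (norm \<Delta>)\<^sup>2"
      by (simp_all add: es_excess_def Let_def zp_def zh_def v_def \<Delta>_def q_def)
    have noT: "S + es_noise \<tau> \<gamma> F h z w j True = e - \<tau> *\<^sub>R (zp - w)"
      and noF: "S + es_noise \<tau> \<gamma> F h z w j False = e + (1 - \<tau>) *\<^sub>R (zp - w)"
      by (simp_all add: es_noise_def e_def zp_def v_def zh_def \<Delta>_def algebra_simps)
    \<comment> \<open>The coin variance involves \<open>zp - w\<close>; the detour through
      \<open>zh\<close> bounds it by the estimator and by \<open>q\<close>.\<close>
    have "(norm (zp - w))\<^sup>2 \<le> 2 * (norm (zp - zh))\<^sup>2 + 2 * q"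
      using norm_add_square_le[of "zp - zh" "zh - w"] by (simp add: q_def norm_minus_commute)
    also have "\<dots> \<le> 2 * (\<gamma>\<^sup>2 * (norm \<Delta>)\<^sup>2) + 2 * q"
      using es_next_es_half_distance[OF h \<gamma>, where z = z and w = w and j = j and \<tau> = \<tau> and F = F] by (simp add: zp_def zh_def \<Delta>_def v_def)
    finally have dist: "(norm (zp - w))\<^sup>2 \<le> 2 * (\<gamma>\<^sup>2 * (norm \<Delta>)\<^sup>2) + 2 * q" .
    have "\<tau> * (1 - \<tau>) * (norm (zp - w))\<^sup>2 \<le> 1 * (1 - \<tau>) * (2 * (\<gamma>\<^sup>2 * (norm \<Delta>)\<^sup>2) + 2 * q)"
      using \<tau> dist by (intro mult_mono) auto
    also have "\<dots> \<le> 2 * (\<gamma>\<^sup>2 * (norm \<Delta>)\<^sup>2) + 2 * ((1 - \<tau>) * q)"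
      using mult_right_mono[of "1 - \<tau>" 1 "\<gamma>\<^sup>2 * (norm \<Delta>)\<^sup>2"] \<tau> by (simp add: algebra_simps)
    finally have var: "\<tau> * (1 - \<tau>) * (norm (zp - w))\<^sup>2 \<le> 2 * (\<gamma>\<^sup>2 * (norm \<Delta>)\<^sup>2) + 2 * ((1 - \<tau>) * q)" .
    have ne: "(norm e)\<^sup>2 = (norm S)\<^sup>2 + 2 * \<gamma> * inner \<Delta> S - 2 * \<gamma> * inner v S
        + \<gamma>\<^sup>2 * (norm \<Delta>)\<^sup>2 - 2 * \<gamma>\<^sup>2 * inner \<Delta> v + \<gamma>\<^sup>2 * N"
      unfolding e_def N_def power2_norm_eq_inner
      by (simp add: inner_simps inner_commute algebra_simps power2_eq_square)
    have "(1 - \<tau>) * (es_excess \<tau> \<gamma> F h z0 z w j True + (norm (S + es_noise \<tau> \<gamma> F h z w j True))\<^sup>2 / 6)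
        + \<tau> * (es_excess \<tau> \<gamma> F h z0 z w j False + (norm (S + es_noise \<tau> \<gamma> F h z w j False))\<^sup>2 / 6)
      = 2 * \<gamma> * inner (v - \<Delta>) (zh - z0) - (1 - \<tau>) * q + \<gamma>\<^sup>2 * (norm \<Delta>)\<^sup>2
        + ((1 - \<tau>) * (norm (e - \<tau> *\<^sub>R (zp - w)))\<^sup>2 + \<tau> * (norm (e + (1 - \<tau>) *\<^sub>R (zp - w)))\<^sup>2) / 6"
      unfolding exT exF noT noF by (simp add: field_simps)
    also have "\<dots> \<le> 2 * \<gamma> * inner (v - \<Delta>) (zh - z0) - (1 - \<tau>) * q + \<gamma>\<^sup>2 * (norm \<Delta>)\<^sup>2
        + ((norm e)\<^sup>2 + (2 * (\<gamma>\<^sup>2 * (norm \<Delta>)\<^sup>2) + 2 * ((1 - \<tau>) * q))) / 6"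
      unfolding mean_square_centered using var by simp
    \<comment> \<open>The constants collect as \<open>1 - 2/6 = 2/3\<close> for
      \<open>(1 - \<tau>) * q\<close> and \<open>1 + 1/6 + 2/6 = 3/2\<close> for the squared
      estimator.\<close>
    also have "\<dots> = (2 * \<gamma> * inner v (zh - z0) - 2 / 3 * (1 - \<tau>) * q
          + ((norm S)\<^sup>2 - 2 * \<gamma> * inner v S + \<gamma>\<^sup>2 * N) / 6)
       + inner \<Delta> (- (2 * \<gamma>) *\<^sub>R (zh - z0) + (\<gamma> / 3) *\<^sub>R S - (\<gamma>\<^sup>2 / 3) *\<^sub>R v)
       + 3 / 2 * \<gamma>\<^sup>2 * (norm \<Delta>)\<^sup>2"
      unfolding ne by (simp add: inner_simps field_simps)
    finally show "(1 - \<tau>) * (es_excess \<tau> \<gamma> F h z0 z w j True + (norm (S + es_noise \<tau> \<gamma> F h z w j True))\<^sup>2 / 6)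
        + \<tau> * (es_excess \<tau> \<gamma> F h z0 z w j False + (norm (S + es_noise \<tau> \<gamma> F h z w j False))\<^sup>2 / 6)
       \<le> (2 * \<gamma> * inner v (zh - z0) - 2 / 3 * (1 - \<tau>) * q
          + ((norm S)\<^sup>2 - 2 * \<gamma> * inner v S + \<gamma>\<^sup>2 * N) / 6)
       + inner (coord_est v j) (- (2 * \<gamma>) *\<^sub>R (zh - z0) + (\<gamma> / 3) *\<^sub>R S - (\<gamma>\<^sup>2 / 3) *\<^sub>R v)
       + 3 / 2 * \<gamma>\<^sup>2 * (norm (coord_est v j))\<^sup>2"
      unfolding \<Delta>_def .
  qed
  \<comment> \<open>With the estimator replaced by its mean \<open>v\<close>, the terms in
    \<open>zh - z0\<close> and in \<open>S\<close> cancel.\<close>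
  also have "\<dots> = (norm S)\<^sup>2 / 6 - 2 / 3 * ((1 - \<tau>) * q) - \<gamma>\<^sup>2 * N / 6 + 3 / 2 * (\<gamma>\<^sup>2 * real CARD('d) * N)"
    by (simp add: inner_simps N_def power2_norm_eq_inner field_simps)
  \<comment> \<open>By \<open>g\<close> the Lipschitz part is at most
    \<open>3/32 * (1 - \<tau>) * q\<close>, within the available
    \<open>2/3 * (1 - \<tau>) * q\<close>.\<close>
  also have "\<dots> \<le> (norm S)\<^sup>2 / 6 + 3 / 2 * \<gamma>\<^sup>2 * real CARD('d) * D\<^sup>2"
  proof -
    have "\<gamma>\<^sup>2 * real CARD('d) * N \<le> \<gamma>\<^sup>2 * real CARD('d) * (L\<^sup>2 * q + D\<^sup>2)"
      using F_variation_bound[OF w, of z] unfolding v_def zh_def q_def N_def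
      by (intro mult_left_mono) auto
    moreover have "\<gamma>\<^sup>2 * (16 * real CARD('d) * L\<^sup>2) * q \<le> (1 - \<tau>) * q"
      using g \<open>0 \<le> q\<close> by (intro mult_right_mono) auto
    moreover have "0 \<le> \<gamma>\<^sup>2 * N" "0 \<le> (1 - \<tau>) * q" using \<open>0 \<le> q\<close> \<open>0 \<le> N\<close> \<tau> by auto
    ultimately show ?thesis by (simp add: algebra_simps add_divide_distrib diff_divide_distrib)
  qed
  finally show ?thesis .
qed

end

subsection \<open>Convergence rates\<close>

text \<open>Brings the step size bound into polynomial form; for \<open>c = 0\<close>, where the
  quotient may be infinite, the claim is just \<open>0 \<le> a\<close>.\<close>

lemma ereal_le_sqrt_divide:
  assumes "ereal \<gamma> \<le> ereal (sqrt a) / ereal c" "0 < \<gamma>" "0 \<le> a" "0 \<le> c"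
  shows "\<gamma>\<^sup>2 * c\<^sup>2 \<le> a"
proof (cases "c = 0")
  case False
  then have "\<gamma> * c \<le> sqrt a" using assms by (simp add: pos_le_divide_eq)
  then have "(\<gamma> * c)\<^sup>2 \<le> (sqrt a)\<^sup>2" using assms by (intro power_mono) auto
  then show ?thesis using assms by (simp add: power_mult_distrib)
qed (use assms in simp)

lemma econvex_convex_on:
  assumes "proper_fun h" "econvex h"
  shows "convex_on (edom h) (\<lambda>x. real_of_ereal (h x))"
proof (rule convex_onI)
  have le: "h ((1 - t) *\<^sub>R x + t *\<^sub>R y) \<le> ereal ((1 - t) * real_of_ereal (h x) + t * real_of_ereal (h y))"
    if "x \<in> edom h" "y \<in> edom h" "0 \<le> t" "t \<le> 1" for x y t
    using that econvexD_real[OF assms(2)]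
    by (metis assms(1) proper_fun_edomE real_of_ereal.simps(1))
  show "convex (edom h)"
    unfolding convex_alt
  proof (intro ballI allI impI)
    fix x y t assume "x \<in> edom h" "y \<in> edom h" "0 \<le> t \<and> t \<le> (1::real)"
    then show "(1 - t) *\<^sub>R x + t *\<^sub>R y \<in> edom h"
      using le[of x y t] by (auto simp: edom_def intro: le_less_trans)
  qed
  fix t :: real and x y assume "0 < t" "t < 1" "x \<in> edom h" "y \<in> edom h"
  then show "real_of_ereal (h ((1 - t) *\<^sub>R x + t *\<^sub>R y)) \<le> (1 - t) * real_of_ereal (h x) + t * real_of_ereal (h y)"
    using le[of x y t] assms(1) by (cases "h ((1 - t) *\<^sub>R x + t *\<^sub>R y)") (auto simp: proper_fun_def)
qed

text \<open>Jensen's inequality for \<open>h\<close> and linearity of the inner product pass from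
  the sum to the average; a \<open>u\<close> outside the domain contributes
  \<open>-\<infinity>\<close> to the supremum.\<close>

lemma Gap_average_le:
  fixes x :: "nat \<Rightarrow> 'a::real_inner"
  assumes "proper_fun h" "econvex h" and K: "0 < K" and x: "\<And>k. k < K \<Longrightarrow> x k \<in> edom h"
    and le: "\<And>u. u \<in> C \<Longrightarrow> u \<in> edom h \<Longrightarrow>
      (\<Sum>k<K. inner (F u) (x k - u) + real_of_ereal (h (x k)) - real_of_ereal (h u)) \<le> real K * B"
  shows "Gap C F h ((1 / real K) *\<^sub>R (\<Sum>k<K. x k)) \<le> ereal B"
  unfolding Gap_def
proof (rule SUP_least)
  fix u assume "u \<in> C"
  let ?x = "(1 / real K) *\<^sub>R (\<Sum>k<K. x k)"
  let ?r = "\<lambda>x. real_of_ereal (h x)"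
  have avg: "?x = (\<Sum>k<K. (1 / real K) *\<^sub>R x k)" by (simp add: scaleR_sum_right)
  have cvx: "convex_on (edom h) ?r" by (rule econvex_convex_on[OF assms(1,2)])
  have "?x \<in> edom h"
    unfolding avg using K x cvx by (intro convex_sum) (auto simp: convex_on_def)
  then obtain a where a: "h ?x = ereal a" using proper_fun_edomE[OF assms(1)] by blast
  show "ereal (inner (F u) (?x - u)) + h ?x - h u \<le> ereal B"
  proof (cases "u \<in> edom h")
    case True
    then obtain c where c: "h u = ereal c" using proper_fun_edomE[OF assms(1)] by blast
    have "?r ?x \<le> (\<Sum>k<K. (1 / real K) * ?r (x k))"
      unfolding avg using K x by (intro convex_on_sum[OF _ _ cvx]) auto
    then have 1: "real K * a \<le> (\<Sum>k<K. ?r (x k))"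
      using K a by (simp add: pos_le_divide_eq mult.commute flip: sum_divide_distrib)
    have "real K * inner (F u) (?x - u) = (\<Sum>k<K. inner (F u) (x k - u))"
      using K by (simp add: inner_diff_right inner_sum_right sum_subtractf right_diff_distrib)
    then have "real K * (inner (F u) (?x - u) + a - c)
        \<le> (\<Sum>k<K. inner (F u) (x k - u) + ?r (x k) - ?r u)"
      using 1 c by (simp add: sum.distrib sum_subtractf algebra_simps)
    also have "\<dots> \<le> real K * B" by (rule le[OF \<open>u \<in> C\<close> True])
    finally show ?thesis using K a c by simp
  qed (simp add: edom_def a)
qed

text \<open>Young's inequality, weighted to match the share \<open>(norm S)\<^sup>2 / 6\<close> of
  the potential.\<close>

lemma double_inner_le_norms:
  fixes a b :: "'a::real_inner"
  shows "2 * inner a b \<le> (norm a)\<^sup>2 / 6 + 6 * (norm b)\<^sup>2"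
proof -
  have "0 \<le> (norm (a - 6 *\<^sub>R b))\<^sup>2" by simp
  also have "\<dots> = (norm a)\<^sup>2 - 12 * inner a b + 36 * (norm b)\<^sup>2"
    unfolding power2_norm_eq_inner by (simp add: inner_simps inner_commute)
  finally show ?thesis by (simp add: field_simps)
qed

section \<open>Rates for the whole run\<close>

context
  fixes h :: "real^'d::finite \<Rightarrow> ereal" and F :: "real^'d \<Rightarrow> real^'d" and Z :: "(real^'d) set"
    and \<tau> \<gamma> L D :: real and zs z0 :: "real^'d" and K :: nat and M :: "'s measure"
    and i :: "nat \<Rightarrow> 's \<Rightarrow> 'd" and b :: "nat \<Rightarrow> 's \<Rightarrow> bool" and z w zh :: "nat \<Rightarrow> 's \<Rightarrow> real^'d"
  assumes h: "proper_fun h" "lower_semicontinuous h" "econvex h" and \<gamma>: "0 < \<gamma>"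
    and Z: "edom h \<subseteq> Z" and \<tau>: "0 \<le> \<tau>" "\<tau> < 1" and lip: "boundedly_Lipschitz Z F L D"
    and VI: "solves_VI Z F h zs" and z0: "z0 \<in> Z" and K: "1 \<le> K"
    and ch: "coord_es_choices M K \<tau> i b"
    and it: "coord_es_iterates M K \<tau> \<gamma> F h z0 i b z w zh"
begin

lemma iterates_0: "\<omega> \<in> space M \<Longrightarrow> z 0 \<omega> = z0" "\<omega> \<in> space M \<Longrightarrow> w 0 \<omega> = z0"
  using it by (auto simp: coord_es_iterates_def)

lemma iterates_Suc:
  assumes "\<omega> \<in> space M" "k < K"
  shows "zh k \<omega> = es_half \<tau> \<gamma> F h (z k \<omega>) (w k \<omega>)"
    and "z (Suc k) \<omega> = es_next \<tau> \<gamma> F h (z k \<omega>) (w k \<omega>) (i k \<omega>)"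
    and "w (Suc k) \<omega> = (if b k \<omega> then es_next \<tau> \<gamma> F h (z k \<omega>) (w k \<omega>) (i k \<omega>) else w k \<omega>)"
proof -
  show zh: "zh k \<omega> = es_half \<tau> \<gamma> F h (z k \<omega>) (w k \<omega>)"
    using it assms by (simp add: coord_es_iterates_def Let_def es_half_def)
  show "z (Suc k) \<omega> = es_next \<tau> \<gamma> F h (z k \<omega>) (w k \<omega>) (i k \<omega>)"
    using it assms zh
    by (simp add: coord_es_iterates_def Let_def es_next_def coord_est_def right_diff_distrib scaleR_diff_left)
  then show "w (Suc k) \<omega> = (if b k \<omega> then es_next \<tau> \<gamma> F h (z k \<omega>) (w k \<omega>) (i k \<omega>) else w k \<omega>)"
    using it assms by (simp add: coord_es_iterates_def Let_def)
qed

text \<open>The drift is iterated; the noise sums to a geometric series below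
  \<open>1 / (1 - a)\<close>, which is \<open>16 / (\<gamma> * (\<mu>F + \<mu>h))\<close>.\<close>

lemma coord_es_strongly_monotone_rate:
  assumes \<mu>: "0 \<le> \<mu>F" "0 \<le> \<mu>h" "0 < \<mu>F + \<mu>h" and sm: "strongly_monotone Z F h \<mu>F \<mu>h"
    and g1: "\<gamma>\<^sup>2 * (8 * real CARD('d) * L\<^sup>2) \<le> 1 - \<tau>" and g2: "\<gamma> * (4 * (\<mu>F + \<mu>h)) \<le> 1 - \<tau>"
  shows "integral\<^sup>L M (\<lambda>\<omega>. \<tau> * (norm (z K \<omega> - zs))\<^sup>2 + (norm (w K \<omega> - zs))\<^sup>2)
     \<le> (1 - \<gamma> * ((\<mu>F + \<mu>h) / 16)) ^ K * (\<tau> * (norm (z0 - zs))\<^sup>2 + (norm (z0 - zs))\<^sup>2)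
       + 16 * \<gamma> * real CARD('d) * D\<^sup>2 / (\<mu>F + \<mu>h)"
proof -
  define a where "a = 1 - \<gamma> * ((\<mu>F + \<mu>h) / 16)"
  define e where "e = \<gamma>\<^sup>2 * real CARD('d) * D\<^sup>2"
  define V where "V = (\<lambda>p :: (real^'d) \<times> (real^'d). \<tau> * (norm (fst p - zs))\<^sup>2 + (norm (snd p - zs))\<^sup>2)"
  define step where "step = (\<lambda>p j c. let zp = es_next \<tau> \<gamma> F h (fst p) (snd p) j in (zp, if c then zp else snd p))"
  have "4 * (\<gamma> * (\<mu>F + \<mu>h)) \<le> 1 - \<tau>" using g2 by (simp only: mult_ac)
  then have a: "0 \<le> a" "a < 1" using \<tau> \<mu> \<gamma> by (auto simp: a_def)
  have "integral\<^sup>L M (\<lambda>\<omega>. V (z K \<omega>, w K \<omega>)) \<le> a ^ K * V (z0, z0) + e * (\<Sum>k<K. a ^ k)"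
  \<comment> \<open>The invariant keeps \<open>w\<close> in \<open>Z\<close>, where the bound on the
    variation of \<open>F\<close> applies.\<close>
  proof (rule chain_drift[OF ch, where s = "\<lambda>k \<omega>. (z k \<omega>, w k \<omega>)" and step = step and I = "\<lambda>p. snd p \<in> Z"])
    fix p :: "(real^'d) \<times> (real^'d)" assume p: "snd p \<in> Z"
    show "choice_mean \<tau> (\<lambda>j c. V (step p j c)) \<le> a * V p + e"
      using strongly_monotone_drift[OF h \<gamma> Z \<tau> lip VI sm \<mu>(1,2) g1 g2 p, of "fst p"]
      by (simp add: V_def step_def Let_def a_def e_def)
  next
    fix p :: "(real^'d) \<times> (real^'d)" and j c assume "snd p \<in> Z"
    then show "snd (step p j c) \<in> Z"
      using es_next_in_edom[OF h \<gamma>] Z by (auto simp: step_def Let_def)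
  qed (use a z0 in \<open>auto simp: iterates_0 iterates_Suc step_def Let_def\<close>)
  also have "e * (\<Sum>k<K. a ^ k) \<le> e * (1 / (1 - a))"
    using a by (intro mult_left_mono) (auto simp: e_def sum_gp_strict divide_le_cancel)
  also have "e * (1 / (1 - a)) = 16 * \<gamma> * real CARD('d) * D\<^sup>2 / (\<mu>F + \<mu>h)"
  proof -
    have "\<gamma>\<^sup>2 * t * (1 / (\<gamma> * (m / 16))) = 16 * \<gamma> * t / m" if "0 < m" for m t :: real
      using \<gamma> that by (simp add: power2_eq_square field_simps)
    from this[OF \<mu>(3), of "real CARD('d) * D\<^sup>2"] show ?thesis by (simp add: e_def a_def mult.assoc)
  qed
  finally show ?thesis by (simp add: V_def a_def)
qed

text \<open>The supremum over \<open>u\<close> sits inside the expectation, so \<open>u\<close> is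
  eliminated on each path first: the gap is bounded by a random \<open>B\<close> free of
  \<open>u\<close>, whose mean is then estimated.\<close>

lemma coord_es_gap_rate:
  assumes C: "compact C" "C \<subseteq> Z" "zs \<in> C" and mono: "strongly_monotone Z F h 0 0"
    and cvx: "convex Z"
    and g: "\<gamma>\<^sup>2 * (16 * real CARD('d) * L\<^sup>2) \<le> 1 - \<tau>"
  shows "(\<integral>\<^sup>+\<omega>. e2ennreal (Gap C F h ((1 / real K) *\<^sub>R (\<Sum>k<K. zh k \<omega>))) \<partial>M)
     \<le> ennreal (4 * (SUP u\<in>C. (norm (z0 - u))\<^sup>2) / (\<gamma> * real K) + 3 / 4 * \<gamma> * real CARD('d) * D\<^sup>2)"
proof -
  interpret prob_space M using ch by (simp add: coord_es_choices_def)
  define R where "R = (SUP u\<in>C. (norm (z0 - u))\<^sup>2)"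
  define S where "S = (\<lambda>n \<omega>. \<Sum>k<n. es_noise \<tau> \<gamma> F h (z k \<omega>) (w k \<omega>) (i k \<omega>) (b k \<omega>))"
  define Y where "Y = (\<lambda>n \<omega>. \<Sum>k<n. es_excess \<tau> \<gamma> F h z0 (z k \<omega>) (w k \<omega>) (i k \<omega>) (b k \<omega>))"
  define \<Phi> where "\<Phi> = (\<lambda>(z :: real^'d, w :: real^'d, S :: real^'d, Y :: real). Y + (norm S)\<^sup>2 / 6)"
  \<comment> \<open>The state carries the running sums \<open>S\<close> and \<open>Y\<close>, so
    that the potential \<open>\<Phi>\<close> is a function of a chain.\<close>
  define step where "step = (\<lambda>(z, w, S, Y) j c. let zp = es_next \<tau> \<gamma> F h z w j in
    (zp, if c then zp else w, S + es_noise \<tau> \<gamma> F h z w j c, Y + es_excess \<tau> \<gamma> F h z0 z w j c))"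
  define s where "s = (\<lambda>n \<omega>. (z n \<omega>, w n \<omega>, S n \<omega>, Y n \<omega>))"
  \<comment> \<open>Of \<open>8 * R\<close>, a share \<open>2 * R\<close> bounds the initial
    distances, as \<open>\<tau> \<le> 1\<close>, and \<open>6 * R\<close> comes from Young's
    inequality.\<close>
  define B where "B = (\<lambda>\<omega>. (8 * R + \<Phi> (s K \<omega>)) / (2 * \<gamma> * real K))"
  let ?x = "\<lambda>\<omega>. (1 / real K) *\<^sub>R (\<Sum>k<K. zh k \<omega>)"
  have s0: "s 0 \<omega> = (z0, z0, 0, 0)" if "\<omega> \<in> space M" for \<omega>
    using that by (simp add: s_def S_def Y_def iterates_0)
  have sS: "s (Suc k) \<omega> = step (s k \<omega>) (i k \<omega>) (b k \<omega>)" if "\<omega> \<in> space M" "k < K" for k \<omega>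
    using that by (simp add: s_def S_def Y_def iterates_Suc step_def Let_def)
  have "integral\<^sup>L M (\<lambda>\<omega>. \<Phi> (s K \<omega>))
      \<le> 1 ^ K * \<Phi> (z0, z0, 0, 0) + (3 / 2 * \<gamma>\<^sup>2 * real CARD('d) * D\<^sup>2) * (\<Sum>k<K. 1 ^ k)"
  proof (rule chain_drift[OF ch s0 sS, where I = "\<lambda>(_, w, _, _). w \<in> Z"])
    fix p :: "(real^'d) \<times> (real^'d) \<times> (real^'d) \<times> real"
    obtain z w S Y where pe: "p = (z, w, S, Y)" by (cases p)
    assume p: "case p of (_, w, _, _) \<Rightarrow> w \<in> Z"
    have "choice_mean \<tau> (\<lambda>j c. \<Phi> (step p j c)) = Y + choice_mean \<tau> (\<lambda>j c. es_excess \<tau> \<gamma> F h z0 z w j c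
           + (norm (S + es_noise \<tau> \<gamma> F h z w j c))\<^sup>2 / 6)"
      by (simp add: \<Phi>_def pe step_def Let_def add.assoc choice_mean_add_const)
    also have "\<dots> \<le> Y + ((norm S)\<^sup>2 / 6 + 3 / 2 * \<gamma>\<^sup>2 * real CARD('d) * D\<^sup>2)"
      using p pe by (intro add_left_mono es_noise_drift[OF h \<gamma> Z \<tau> lip g]) simp
    finally show "choice_mean \<tau> (\<lambda>j c. \<Phi> (step p j c)) \<le> 1 * \<Phi> p + 3 / 2 * \<gamma>\<^sup>2 * real CARD('d) * D\<^sup>2"
      by (simp add: \<Phi>_def pe)
  next
    fix p :: "(real^'d) \<times> (real^'d) \<times> (real^'d) \<times> real" and j c
    assume "case p of (_, w, _, _) \<Rightarrow> w \<in> Z"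
    then show "case step p j c of (_, w, _, _) \<Rightarrow> w \<in> Z"
      using es_next_in_edom[OF h \<gamma>] Z by (cases p) (auto simp: step_def Let_def)
  qed (use z0 in auto)
  then have E\<Phi>: "integral\<^sup>L M (\<lambda>\<omega>. \<Phi> (s K \<omega>)) \<le> 3 / 2 * \<gamma>\<^sup>2 * real CARD('d) * D\<^sup>2 * real K"
    by (simp add: \<Phi>_def)
  have int: "integrable M (\<lambda>\<omega>. \<Phi> (s K \<omega>))"
    by (rule chain_integrable[OF ch s0 sS]) auto
  have zhE: "zh k \<omega> \<in> edom h" if "\<omega> \<in> space M" "k < K" for k \<omega>
    using that es_half_in_edom[OF h \<gamma>] by (simp add: iterates_Suc)
  have gap: "Gap C F h (?x \<omega>) \<le> ereal (B \<omega>)" if \<omega>: "\<omega> \<in> space M" for \<omega>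
  proof (rule Gap_average_le[OF h(1,3)])
    fix u assume u: "u \<in> C" "u \<in> edom h"
    define g where "g = (\<lambda>k. inner (F u) (zh k \<omega> - u) + real_of_ereal (h (zh k \<omega>)) - real_of_ereal (h u))"
    \<comment> \<open>For this fixed \<open>u\<close> the one-step bounds telescope along the
      path.\<close>
    have "2 * \<gamma> * (\<Sum>k<n. g k) \<le> (\<tau> * (norm (z0 - u))\<^sup>2 + (norm (z0 - u))\<^sup>2)
        - (\<tau> * (norm (z n \<omega> - u))\<^sup>2 + (norm (w n \<omega> - u))\<^sup>2) + 2 * inner (S n \<omega>) (u - z0) + Y n \<omega>"
      if "n \<le> K" for n
      using that
    proof (induction n)
      case 0
      then show ?case using \<omega> by (simp add: iterates_0 S_def Y_def)
    next
      case (Suc n)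
      have "2 * \<gamma> * g n \<le> (\<tau> * (norm (z n \<omega> - u))\<^sup>2 + (norm (w n \<omega> - u))\<^sup>2)
        - (\<tau> * (norm (z (Suc n) \<omega> - u))\<^sup>2 + (norm (w (Suc n) \<omega> - u))\<^sup>2)
        + 2 * inner (es_noise \<tau> \<gamma> F h (z n \<omega>) (w n \<omega>) (i n \<omega>) (b n \<omega>)) (u - z0)
        + es_excess \<tau> \<gamma> F h z0 (z n \<omega>) (w n \<omega>) (i n \<omega>) (b n \<omega>)"
        using es_gap_step[OF h \<gamma> u(2) Z \<tau>(1) mono, where z = "z n \<omega>" and w = "w n \<omega>"
            and j = "i n \<omega>" and c = "b n \<omega>" and ?z0.0 = z0] Suc.prems \<omega>
        by (simp add: iterates_Suc g_def)
      then show ?case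
        using Suc by (simp add: S_def Y_def inner_add_left distrib_left)
    qed
    from this[of K] have 1: "2 * \<gamma> * (\<Sum>k<K. g k) \<le> (\<tau> * (norm (z0 - u))\<^sup>2 + (norm (z0 - u))\<^sup>2)
        - (\<tau> * (norm (z K \<omega> - u))\<^sup>2 + (norm (w K \<omega> - u))\<^sup>2) + 2 * inner (S K \<omega>) (u - z0) + Y K \<omega>"
      by simp
    have "bdd_above ((\<lambda>u. (norm (z0 - u))\<^sup>2) ` C)"
      by (intro bounded_imp_bdd_above compact_imp_bounded compact_continuous_image C continuous_intros)
    then have 2: "(norm (z0 - u))\<^sup>2 \<le> R" unfolding R_def by (intro cSUP_upper u)
    have "2 * inner (S K \<omega>) (u - z0) \<le> (norm (S K \<omega>))\<^sup>2 / 6 + 6 * (norm (z0 - u))\<^sup>2"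
      using double_inner_le_norms[of "S K \<omega>" "u - z0"] by (simp add: norm_minus_commute)
    moreover have "\<tau> * (norm (z0 - u))\<^sup>2 \<le> 1 * (norm (z0 - u))\<^sup>2"
      using \<tau> by (intro mult_right_mono) auto
    moreover have "0 \<le> \<tau> * (norm (z K \<omega> - u))\<^sup>2" using \<tau> by simp
    moreover have "0 \<le> (norm (w K \<omega> - u))\<^sup>2" by simp
    ultimately have "2 * \<gamma> * (\<Sum>k<K. g k) \<le> 8 * R + \<Phi> (s K \<omega>)"
      using 1 2 unfolding \<Phi>_def s_def prod.case by linarith
    also have "\<dots> = 2 * \<gamma> * (real K * B \<omega>)" using \<gamma> K by (simp add: B_def)
    finally show "(\<Sum>k<K. inner (F u) (zh k \<omega> - u) + real_of_ereal (h (zh k \<omega>)) - real_of_ereal (h u)) \<le> real K * B \<omega>"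
      using \<gamma> by (simp add: g_def)
  qed (use K zhE[OF \<omega>] in auto)
  \<comment> \<open>Nonnegativity, used to pass from the nonnegative integral to the Bochner
    integral, is inherited from the gap: \<open>zs \<in> C\<close> contributes a nonnegative term at
    any point of \<open>Z\<close>.\<close>
  have pos: "0 \<le> B \<omega>" if \<omega>: "\<omega> \<in> space M" for \<omega>
  proof -
    have "?x \<omega> \<in> Z"
      unfolding scaleR_sum_right using zhE[OF \<omega>] Z K by (intro convex_sum[OF _ cvx]) auto
    then have "0 \<le> Gap C F h (?x \<omega>)"
      unfolding Gap_def using VI C(3) by (intro SUP_upper2[OF C(3)]) (auto simp: solves_VI_def)
    then have "0 \<le> ereal (B \<omega>)" using gap[OF \<omega>] by (rule order_trans)
    then show ?thesis by simp
  qed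
  have "(\<integral>\<^sup>+\<omega>. e2ennreal (Gap C F h (?x \<omega>)) \<partial>M) \<le> (\<integral>\<^sup>+\<omega>. ennreal (B \<omega>) \<partial>M)"
    using e2ennreal_mono[OF gap] by (intro nn_integral_mono) simp
  also have "\<dots> = ennreal (integral\<^sup>L M B)"
    using int pos by (intro nn_integral_eq_integral) (auto simp: B_def)
  also have "\<dots> \<le> ennreal (4 * R / (\<gamma> * real K) + 3 / 4 * \<gamma> * real CARD('d) * D\<^sup>2)"
  proof (rule ennreal_leI)
    have "integral\<^sup>L M B = (8 * R + integral\<^sup>L M (\<lambda>\<omega>. \<Phi> (s K \<omega>))) / (2 * \<gamma> * real K)"
      unfolding B_def using int by (simp add: prob_space)
    also have "\<dots> \<le> (8 * R + 3 / 2 * \<gamma>\<^sup>2 * real CARD('d) * D\<^sup>2 * real K) / (2 * \<gamma> * real K)"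
      using E\<Phi> \<gamma> by (intro divide_right_mono) auto
    also have "\<dots> = 4 * R / (\<gamma> * real K) + 3 / 4 * \<gamma> * real CARD('d) * D\<^sup>2"
      using \<gamma> K by (simp add: field_simps power2_eq_square)
    finally show "integral\<^sup>L M B \<le> 4 * R / (\<gamma> * real K) + 3 / 4 * \<gamma> * real CARD('d) * D\<^sup>2" .
  qed
  finally show ?thesis unfolding R_def .
qed

end

theorem mainTheorem7:
  fixes h :: "real^'d::finite \<Rightarrow> ereal" and F :: "real^'d \<Rightarrow> real^'d"
    and Z :: "(real^'d) set" and zs z0 :: "real^'d"
    and \<tau> \<gamma> L D :: real and K :: nat
    and M :: "'s measure"
    and i :: "nat \<Rightarrow> 's \<Rightarrow> 'd" and b :: "nat \<Rightarrow> 's \<Rightarrow> bool"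
    and z w zh :: "nat \<Rightarrow> 's \<Rightarrow> real^'d"
  assumes "proper_fun h" and "lower_semicontinuous h" and "econvex h"
    and "Z \<noteq> {}" and "closed Z" and "convex Z" and "edom h \<subseteq> Z"
    and "0 \<le> \<tau>" and "\<tau> < 1"
    and "solves_VI Z F h zs"
    and "0 \<le> L" and "boundedly_Lipschitz Z F L D"
    and "z0 \<in> Z" and "1 \<le> K" and "0 < \<gamma>"
    and "coord_es_choices M K \<tau> i b"
    and "coord_es_iterates M K \<tau> \<gamma> F h z0 i b z w zh"
  shows
    "(\<forall>\<mu>F \<mu>h. 0 \<le> \<mu>F \<longrightarrow> 0 \<le> \<mu>h \<longrightarrow> 0 < \<mu>F + \<mu>h \<longrightarrow> strongly_monotone Z F h \<mu>F \<mu>h \<longrightarrow>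
        \<comment> \<open>division in \<^typ>\<open>ereal\<close>: the first bound is \<open>\<infinity>\<close> when \<open>L = 0\<close>\<close>
        ereal \<gamma> \<le> min (ereal (sqrt (1 - \<tau>)) / ereal (2 * sqrt (2 * real CARD('d)) * L))
                       (ereal ((1 - \<tau>) / (4 * (\<mu>F + \<mu>h)))) \<longrightarrow>
        prob_space.expectation M (\<lambda>\<omega>. \<tau> * (norm (z K \<omega> - zs))\<^sup>2 + (norm (w K \<omega> - zs))\<^sup>2)
          \<le> (1 - \<gamma> * ((\<mu>F + \<mu>h) / 16)) ^ (K - 1)
               * (\<tau> * (norm (z0 - zs))\<^sup>2 + (norm (z0 - zs))\<^sup>2)
             + 32 * \<gamma> * real CARD('d) * D\<^sup>2 / (\<mu>F + \<mu>h))
     \<and>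
     (\<forall>C. compact C \<longrightarrow> C \<subseteq> Z \<longrightarrow> zs \<in> C \<longrightarrow> strongly_monotone Z F h 0 0 \<longrightarrow>
        ereal \<gamma> \<le> ereal (sqrt (1 - \<tau>)) / ereal (2 * L * sqrt (4 * real CARD('d) + 2)) \<longrightarrow>
        \<comment> \<open>\<open>Gap\<close> is extended-valued and nonnegative on \<open>Z\<close>, as \<open>zs \<in> C\<close>\<close>
        (\<integral>\<^sup>+\<omega>. e2ennreal (Gap C F h ((1 / real K) *\<^sub>R (\<Sum>k<K. zh k \<omega>))) \<partial>M)
          \<le> ennreal (8 * (SUP u\<in>C. (norm (z0 - u))\<^sup>2) / (\<gamma> * real K) + \<gamma> * (9 * real CARD('d) + 2) * D\<^sup>2))"
proof (intro conjI allI impI)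
  fix \<mu>F \<mu>h :: real
  assume \<mu>: "0 \<le> \<mu>F" "0 \<le> \<mu>h" "0 < \<mu>F + \<mu>h" and sm: "strongly_monotone Z F h \<mu>F \<mu>h"
    and g: "ereal \<gamma> \<le> min (ereal (sqrt (1 - \<tau>)) / ereal (2 * sqrt (2 * real CARD('d)) * L))
                       (ereal ((1 - \<tau>) / (4 * (\<mu>F + \<mu>h))))"
  define a where "a = 1 - \<gamma> * ((\<mu>F + \<mu>h) / 16)"
  define V where "V = \<tau> * (norm (z0 - zs))\<^sup>2 + (norm (z0 - zs))\<^sup>2"
  \<comment> \<open>The square of \<open>2 * sqrt (2 * real CARD('d)) * L\<close> is
    \<open>8 * real CARD('d) * L\<^sup>2\<close>.\<close>
  have g1: "\<gamma>\<^sup>2 * (8 * real CARD('d) * L\<^sup>2) \<le> 1 - \<tau>"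
    using ereal_le_sqrt_divide[of \<gamma> "1 - \<tau>" "2 * sqrt (2 * real CARD('d)) * L"] g assms
    by (simp add: power_mult_distrib)
  have g2: "\<gamma> * (4 * (\<mu>F + \<mu>h)) \<le> 1 - \<tau>"
    using g \<mu>(3) by (simp add: pos_le_divide_eq)
  have "4 * (\<gamma> * (\<mu>F + \<mu>h)) \<le> 1 - \<tau>" using g2 by (simp only: mult_ac)
  then have a: "0 \<le> a" "a \<le> 1" using assms(8,15) \<mu> by (auto simp: a_def)
  have "prob_space.expectation M (\<lambda>\<omega>. \<tau> * (norm (z K \<omega> - zs))\<^sup>2 + (norm (w K \<omega> - zs))\<^sup>2)
     \<le> a ^ K * V + 16 * \<gamma> * real CARD('d) * D\<^sup>2 / (\<mu>F + \<mu>h)"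
    unfolding a_def V_def
    by (rule coord_es_strongly_monotone_rate[OF assms(1,2,3,15,7,8,9,12,10,13,14,16,17) \<mu> sm g1 g2])
  \<comment> \<open>Since \<open>a\<close> lies in \<open>[0, 1]\<close>, lowering the exponent to
    \<open>K - 1\<close> only increases the bound; the constant grows from 16 to 32.\<close>
  also have "\<dots> \<le> a ^ (K - 1) * V + 32 * \<gamma> * real CARD('d) * D\<^sup>2 / (\<mu>F + \<mu>h)"
    using a assms \<mu> by (intro add_mono mult_right_mono power_decreasing divide_right_mono) (auto simp: V_def)
  finally show "prob_space.expectation M (\<lambda>\<omega>. \<tau> * (norm (z K \<omega> - zs))\<^sup>2 + (norm (w K \<omega> - zs))\<^sup>2)
          \<le> (1 - \<gamma> * ((\<mu>F + \<mu>h) / 16)) ^ (K - 1)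
               * (\<tau> * (norm (z0 - zs))\<^sup>2 + (norm (z0 - zs))\<^sup>2)
             + 32 * \<gamma> * real CARD('d) * D\<^sup>2 / (\<mu>F + \<mu>h)"
    unfolding a_def V_def .
next
  fix C
  assume C: "compact C" "C \<subseteq> Z" "zs \<in> C" and mono: "strongly_monotone Z F h 0 0"
    and g: "ereal \<gamma> \<le> ereal (sqrt (1 - \<tau>)) / ereal (2 * L * sqrt (4 * real CARD('d) + 2))"
  define R where "R = (SUP u\<in>C. (norm (z0 - u))\<^sup>2)"
  have "\<gamma>\<^sup>2 * (2 * L * sqrt (4 * real CARD('d) + 2))\<^sup>2 \<le> 1 - \<tau>"
    using ereal_le_sqrt_divide[OF g] assms by simp
  \<comment> \<open>The squared denominator is
    \<open>16 * real CARD('d) * L\<^sup>2 + 8 * L\<^sup>2\<close>; the second summand is nonnegative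
    and is dropped.\<close>
  then have "\<gamma>\<^sup>2 * (16 * real CARD('d) * L\<^sup>2) + 8 * (\<gamma>\<^sup>2 * L\<^sup>2) \<le> 1 - \<tau>"
    by (simp add: power_mult_distrib algebra_simps)
  moreover have "0 \<le> 8 * (\<gamma>\<^sup>2 * L\<^sup>2)" by simp
  ultimately have g1: "\<gamma>\<^sup>2 * (16 * real CARD('d) * L\<^sup>2) \<le> 1 - \<tau>" by linarith
  have bdd: "bdd_above ((\<lambda>u. (norm (z0 - u))\<^sup>2) ` C)"
    by (intro bounded_imp_bdd_above compact_imp_bounded compact_continuous_image C continuous_intros)
  have "0 \<le> (norm (z0 - zs))\<^sup>2" by simp
  also have "\<dots> \<le> R" unfolding R_def by (intro cSUP_upper C bdd)
  finally have "0 \<le> R" .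
  have "(\<integral>\<^sup>+\<omega>. e2ennreal (Gap C F h ((1 / real K) *\<^sub>R (\<Sum>k<K. zh k \<omega>))) \<partial>M)
      \<le> ennreal (4 * R / (\<gamma> * real K) + 3 / 4 * \<gamma> * real CARD('d) * D\<^sup>2)"
    unfolding R_def
    by (rule coord_es_gap_rate[OF assms(1,2,3,15,7,8,9,12,10,13,14,16,17) C mono assms(6) g1])
  also have "\<dots> \<le> ennreal (8 * R / (\<gamma> * real K) + \<gamma> * (9 * real CARD('d) + 2) * D\<^sup>2)"
  proof (intro ennreal_leI add_mono)
    show "4 * R / (\<gamma> * real K) \<le> 8 * R / (\<gamma> * real K)"
      using \<open>0 \<le> R\<close> assms by (intro divide_right_mono) auto
    have "3 / 4 * real CARD('d) * (\<gamma> * D\<^sup>2) \<le> (9 * real CARD('d) + 2) * (\<gamma> * D\<^sup>2)"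
      using assms by (intro mult_right_mono) auto
    then show "3 / 4 * \<gamma> * real CARD('d) * D\<^sup>2 \<le> \<gamma> * (9 * real CARD('d) + 2) * D\<^sup>2"
      by (simp add: mult_ac)
  qed
  finally show "(\<integral>\<^sup>+\<omega>. e2ennreal (Gap C F h ((1 / real K) *\<^sub>R (\<Sum>k<K. zh k \<omega>))) \<partial>M)
          \<le> ennreal (8 * (SUP u\<in>C. (norm (z0 - u))\<^sup>2) / (\<gamma> * real K) + \<gamma> * (9 * real CARD('d) + 2) * D\<^sup>2)"
    unfolding R_def .
qed

end
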